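(* Let $a_1>a_2$, $b_1>b_2$, $N>0$, $t\in(0,1)$, and let $w_{1,k}(x)=e^{-\frac{N}{2t}(x^2-2a_kx)}$ ($k=1,2$), $w_{2,l}(x)=e^{-\frac{N}{2(1-t)}(x^2-2b_lx)}$ ($l=1,2$). Let $\mathbf n=(n_1,n_2)$, $\mathbf m=(m_1,m_2)$ be pairs of positive integers with $n_1+n_2=m_1+m_2$, and let $c_{i,j}$, $1\le i,j\le4$, be the entries of the matrix $(Y_1)_{\mathbf n,\mathbf m}$ defined in the context. Then the $2\times2$ matrix $$\begin{pmatrix}c_{1,3}c_{3,1}&c_{1,4}c_{4,1}\\c_{2,3}c_{3,2}&c_{2,4}c_{4,2}\end{pmatrix}$$ has row sums equal to $t(1-t)\frac{n_k}{N}$, $k=1,2$, and column sums equal to $t(1-t)\frac{m_l}{N}$, $l=1,2$. If moreover $n_1=m_1$ and $n_2=m_2$, then all the products $c_{i,j}c_{j,i}$, $1\le i<j\le4$, can be expressed in terms of $c_{1,2}c_{2,1}$ and $c_{1,4}c_{4,1}$ alone, by means of the relations $$c_{2,3}c_{3,2}=c_{1,4}c_{4,1},\qquad c_{1,3}c_{3,1}=t(1-t)\tfrac{n_1}{N}-c_{1,4}c_{4,1},\qquad c_{2,4}c_{4,2}=t(1-t)\tfrac{n_2}{N}-c_{1,4}c_{4,1},$$ $$t^2(b_1-b_2)^2\,c_{3,4}c_{4,3}=(1-t)^2(a_1-a_2)^2\,c_{1,2}c_{2,1}.$$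
   Context: For $\mathbf n,\mathbf m$ with $n_1+n_2=m_1+m_2$, $Y=Y_{\mathbf n,\mathbf m}$ is the unique $4\times4$ matrix-valued function (known to exist for these weights) with: (1) $Y$ analytic in $\mathbb C\setminus\mathbb R$; (2) $Y_+(x)=Y_-(x)\begin{pmatrix}I_2&W(x)\\0&I_2\end{pmatrix}$ for $x\in\mathbb R$, where $W(x)=\big(w_{1,k}(x)w_{2,l}(x)\big)_{k,l=1}^2$ and $Y_\pm$ are limiting values from the upper/lower half plane; (3) $Y(z)=\left(I+\frac{Y_1}{z}+O(z^{-2})\right)\mathrm{diag}(z^{n_1},z^{n_2},z^{-m_1},z^{-m_2})$ as $z\to\infty$, which defines the constant matrix $Y_1=(Y_1)_{\mathbf n,\mathbf m}$. *)

theory Defs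
  imports "HOL-Complex_Analysis.Complex_Analysis" "HOL-Library.Landau_Symbols"
begin

(* the infix $ denotes vector and matrix components here, not coefficients of power series *)
no_notation fps_nth (infixl \<open>$\<close> 75)

definition w1 :: "real \<Rightarrow> real \<Rightarrow> real^2 \<Rightarrow> 2 \<Rightarrow> real \<Rightarrow> real" where
  "w1 N t a k x = exp (- (N / (2 * t)) * (x\<^sup>2 - 2 * a $ k * x))"

definition w2 :: "real \<Rightarrow> real \<Rightarrow> real^2 \<Rightarrow> 2 \<Rightarrow> real \<Rightarrow> real" where
  "w2 N t b l x = exp (- (N / (2 * (1 - t))) * (x\<^sup>2 - 2 * b $ l * x))"

definition W :: "real \<Rightarrow> real \<Rightarrow> real^2 \<Rightarrow> real^2 \<Rightarrow> real \<Rightarrow> complex^2^2" where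
  "W N t a b x = (\<chi> k l. complex_of_real (w1 N t a k x * w2 N t b l x))"

text \<open>The block matrix with identity diagonal blocks, upper right block \<open>A\<close> and lower left block 0.\<close>

definition jump_matrix :: "complex^2^2 \<Rightarrow> complex^4^4" where
  "jump_matrix A = vector
     [vector [1, 0, A $ 1 $ 1, A $ 1 $ 2],
      vector [0, 1, A $ 2 $ 1, A $ 2 $ 2],
      vector [0, 0, 1, 0],
      vector [0, 0, 0, 1]]"

definition diag4 :: "complex \<Rightarrow> complex \<Rightarrow> complex \<Rightarrow> complex \<Rightarrow> complex^4^4" where
  "diag4 p q r s = vector
     [vector [p, 0, 0, 0], vector [0, q, 0, 0], vector [0, 0, r, 0], vector [0, 0, 0, s]]"

text \<open>
  \<open>Y\<close> solves the Riemann--Hilbert problem with jump data \<open>V\<close> and multi-indices \<open>n\<close>, \<open>m\<close>, and \<open>Y1\<close>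
  is the coefficient of \<open>1/z\<close> in its expansion at infinity. The values of \<open>Y\<close> on the real line are
  irrelevant: the limits \<open>Y\<^sub>+\<close>, \<open>Y\<^sub>-\<close> are taken within the open half planes, and \<open>z\<close> tends to infinity
  within \<open>\<complex> - \<real>\<close>.
\<close>

definition RH_solution ::
  "(real \<Rightarrow> complex^2^2) \<Rightarrow> nat^2 \<Rightarrow> nat^2 \<Rightarrow> (complex \<Rightarrow> complex^4^4) \<Rightarrow> complex^4^4 \<Rightarrow> bool" where
  "RH_solution V n m Y Y1 \<longleftrightarrow>
     (\<forall>i j. (\<lambda>z. Y z $ i $ j) analytic_on (- \<real>)) \<and>
     (\<forall>x::real. \<exists>Yp Ym.
        (Y \<longlongrightarrow> Yp) (at (complex_of_real x) within {z. Im z > 0}) \<and>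
        (Y \<longlongrightarrow> Ym) (at (complex_of_real x) within {z. Im z < 0}) \<and>
        Yp = Ym ** jump_matrix (V x)) \<and>
     (\<exists>R :: complex \<Rightarrow> complex^4^4.
        (\<forall>z. z \<notin> \<real> \<longrightarrow>
           Y z = (mat 1 + (\<chi> i j. Y1 $ i $ j / z) + R z) **
             diag4 (z ^ (n $ 1)) (z ^ (n $ 2))
                   (z powi (- int (m $ 1))) (z powi (- int (m $ 2)))) \<and>
        (\<forall>i j. (\<lambda>z. R z $ i $ j) \<in> O[inf at_infinity (principal (- \<real>))](\<lambda>z. z powi (- 2))))"

end

theory Submission
  imports Defs
begin

text \<open>
  Multiply \<open>Y\<close> from the right by the diagonal matrix \<open>G = diag (w1 1, w1 2, 1 / w2 1, 1 / w2 2)\<close>. The weights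
  are exponentials of quadratic polynomials, so \<open>G\<close> is entire, and since the weight matrix has rank
  one the jump of \<open>Y G\<close> is a constant matrix. Multiplying by that constant in the lower half plane
  gives an entire matrix function \<open>X\<close> of nonvanishing determinant (lemma \<open>entire_frame\<close>). Its
  logarithmic derivative \<open>A = X' / X\<close> is entire and grows linearly, because that of \<open>G\<close> does; so \<open>A\<close>
  is a matrix polynomial of degree one (lemma \<open>lax_matrix_linear\<close>). The expansion of \<open>Y\<close> at infinity
  can be differentiated only at some distance from the real line, so the bound on \<open>A\<close> contains a term
  \<open>1 / |Im z|\<close>; lemma \<open>entire_linear_if_growth_off_real_line\<close> shows that this does no harm.

  Write \<open>\<Lambda> = diag p z + diag q\<close> for the logarithmic derivative of \<open>G\<close> and \<open>\<nu> = (n\<^sub>1, n\<^sub>2, -m\<^sub>1, -m\<^sub>2)\<close>.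
  Comparing coefficients in \<open>A F = F' + F (diag \<nu> / z + \<Lambda>)\<close>, where \<open>F = I + c / z + \<dots>\<close> is \<open>Y\<close> without its
  powers at infinity, gives
  \<open>\<Sum>\<^sub>k c\<^sub>i\<^sub>k (p\<^sub>k - p\<^sub>i) c\<^sub>k\<^sub>j + (q\<^sub>i - q\<^sub>j) c\<^sub>i\<^sub>j = \<delta>\<^sub>i\<^sub>j \<nu>\<^sub>j\<close>
  for all \<open>i, j\<close> in the same \<open>2 \<times> 2\<close> diagonal block (theorem \<open>coefficient_identity\<close>). As \<open>p\<close> is constant
  on each block, with values differing by \<open>N / (t (1 - t))\<close>, the cases \<open>i = j\<close> are the row and column
  sums. The cases \<open>i \<noteq> j\<close> express \<open>c\<^sub>1\<^sub>2, c\<^sub>2\<^sub>1, c\<^sub>3\<^sub>4, c\<^sub>4\<^sub>3\<close> by the entries of the off-diagonal blocks, and the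
  last relation follows by comparing the two products, given that the matrix of the theorem is
  symmetric when \<open>n = m\<close>.
\<close>

section \<open>Matrices with holomorphic entries\<close>

definition diag :: "('n \<Rightarrow> complex) \<Rightarrow> complex^'n^'n" where
  "diag d = (\<chi> i j. if i = j then d j else 0)"

lemma matrix_mult_diag: "(A ** diag d) $ i $ j = A $ i $ j * d j"
  by (simp add: diag_def matrix_matrix_mult_def if_distrib cong: if_cong)

lemma det_diag: "det (diag d) = (\<Prod>i\<in>UNIV. d i)"
  by (subst det_diagonal) (auto simp: diag_def)

text \<open>
  Cramer's rule expresses the inverse through determinants; in this form holomorphy and bounds pass
  from the entries of a matrix to those of its inverse.
\<close>

definition adjugate :: "complex^'n^'n \<Rightarrow> complex^'n^'n" where
  "adjugate A = (\<chi> i j. det (\<chi> k l. if l = i then mat 1 $ k $ j else A $ k $ l))"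

lemma matrix_mult_adjugate:
  fixes A :: "complex^'n^'n"
  assumes "det A \<noteq> 0"
  shows "A ** (\<chi> i j. adjugate A $ i $ j / det A) = mat 1"
proof -
  have "(A ** (\<chi> i j. adjugate A $ i $ j / det A)) $ k $ j = mat 1 $ k $ j" for k j
  proof -
    have "A *v (\<chi> i. adjugate A $ i $ j / det A) = (\<chi> k. mat 1 $ k $ j)"
      using assms by (subst cramer) (simp_all add: adjugate_def cong: if_cong)
    then have "(A *v (\<chi> i. adjugate A $ i $ j / det A)) $ k = mat 1 $ k $ j"
      by simp
    then show ?thesis
      by (simp add: matrix_matrix_mult_def matrix_vector_mult_def)
  qed
  then show ?thesis
    by (simp add: vec_eq_iff)
qed

lemma det_holomorphic_on:
  fixes A :: "complex \<Rightarrow> complex^'n^'n"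
  assumes "\<And>i j. (\<lambda>z. A z $ i $ j) holomorphic_on S"
  shows "(\<lambda>z. det (A z)) holomorphic_on S"
  unfolding det_def by (intro holomorphic_intros assms)

lemma adjugate_holomorphic_on:
  fixes A :: "complex \<Rightarrow> complex^'n^'n"
  assumes "\<And>i j. (\<lambda>z. A z $ i $ j) holomorphic_on S"
  shows "(\<lambda>z. adjugate (A z) $ i $ j) holomorphic_on S"
proof -
  have "(\<lambda>z. if l = i then mat 1 $ k $ j else A z $ k $ l) holomorphic_on S" for k l
    using assms by (cases "l = i") auto
  then show ?thesis
    by (simp add: adjugate_def det_holomorphic_on)
qed

lemma norm_det_le:
  fixes A :: "complex^'n^'n"
  assumes "\<And>i j. norm (A $ i $ j) \<le> B"
  shows "norm (det A) \<le> fact CARD('n) * B ^ CARD('n)"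
proof -
  have "norm (of_int (sign p) * (\<Prod>i\<in>UNIV. A $ i $ p i)) \<le> B ^ CARD('n)" for p
  proof -
    have "norm (of_int (sign p) * (\<Prod>i\<in>UNIV. A $ i $ p i)) = (\<Prod>i\<in>UNIV. norm (A $ i $ p i))"
      by (simp add: norm_mult sign_def flip: prod_norm)
    also have "\<dots> \<le> (\<Prod>i\<in>(UNIV::'n set). B)"
      using assms by (intro prod_mono) auto
    finally show ?thesis by simp
  qed
  then have "norm (det A) \<le> (\<Sum>p | p permutes (UNIV::'n set). B ^ CARD('n))"
    unfolding det_def by (intro sum_norm_le) auto
  then show ?thesis
    by (simp add: card_permutations)
qed

lemma norm_adjugate_le:
  fixes A :: "complex^'n^'n"
  assumes "\<And>i j. norm (A $ i $ j) \<le> B" and "1 \<le> B"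
  shows "norm (adjugate A $ i $ j) \<le> fact CARD('n) * B ^ CARD('n)"
  unfolding adjugate_def vec_lambda_beta
  by (rule norm_det_le) (use assms in \<open>auto simp: mat_def intro: order.trans\<close>)

lemma det_tendsto:
  fixes A :: "'a \<Rightarrow> complex^'n^'n"
  assumes "\<And>i j. ((\<lambda>z. A z $ i $ j) \<longlongrightarrow> L $ i $ j) G"
  shows "((\<lambda>z. det (A z)) \<longlongrightarrow> det L) G"
  unfolding det_def by (intro tendsto_intros assms)

section \<open>Two facts on entire functions\<close>

text \<open>
  The limits are only assumed pointwise, but a limit within the whole open half plane at every real
  point already makes the extended function continuous: nearby boundary values are limits of nearby
  values in the half plane. Morera's theorem then removes the line.
\<close>

lemma holomorphic_extension_across_real_line:
  assumes hol: "f holomorphic_on - \<real>"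
    and lim: "\<And>x::real. \<exists>L. (f \<longlongrightarrow> L) (at (complex_of_real x) within {z. Im z > 0}) \<and>
                 (f \<longlongrightarrow> L) (at (complex_of_real x) within {z. Im z < 0})"
  obtains g where "g holomorphic_on UNIV" "\<And>z. z \<notin> \<real> \<Longrightarrow> g z = f z"
proof -
  have halves: "{z. Im z > 0} \<union> {z. Im z < 0} = - \<real>"
    by (auto simp: complex_is_Real_iff)
  obtain L where up: "\<And>x. (f \<longlongrightarrow> L x) (at (complex_of_real x) within {z. Im z > 0})"
    and down: "\<And>x. (f \<longlongrightarrow> L x) (at (complex_of_real x) within {z. Im z < 0})"
    using lim by metis
  have L: "(f \<longlongrightarrow> L x) (at (complex_of_real x) within - \<real>)" for x
    using Lim_Un[OF up down] halves by simp
  define g where "g z = (if z \<in> \<real> then L (Re z) else f z)" for z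
  have open_compl: "open (- (\<real> :: complex set))"
    using closed_complex_Reals by (simp add: open_Compl)
  have cont: "isCont g z" for z
  proof (cases "z \<in> \<real>")
    case False
    have "isCont f z"
      using hol False open_compl
      by (metis ComplI continuous_on_eq_continuous_at holomorphic_on_imp_continuous_on)
    moreover have "eventually (\<lambda>w. g w = f w) (nhds z)"
      using eventually_nhds_in_open[OF open_compl, of z] False
      by (auto elim!: eventually_mono simp: g_def)
    ultimately show ?thesis
      by (simp add: isCont_cong)
  next
    case True
    then obtain x where x: "z = of_real x"
      by (auto elim: Reals_cases)
    have "\<exists>d>0. \<forall>w. dist w z < d \<longrightarrow> dist (g w) (g z) < e" if "e > 0" for e
    proof -
      have "eventually (\<lambda>w. dist (f w) (L x) < e / 2) (at z within - \<real>)"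
        using L[of x] that unfolding x by (intro tendstoD) auto
      then obtain d where d: "d > 0"
        "\<And>w. \<lbrakk>w \<notin> \<real>; dist w z < d\<rbrakk> \<Longrightarrow> dist (f w) (L x) < e / 2"
        using True unfolding eventually_at by (metis ComplI)
      have "dist (g w) (g z) < e" if w: "dist w z < d" for w
      proof (cases "w \<in> \<real>")
        case False
        then show ?thesis
          using d(2)[OF False w] True x \<open>e > 0\<close> by (simp add: g_def)
      next
        case wreal: True
        then obtain y where y: "w = of_real y"
          by (auto elim: Reals_cases)
        have "eventually (\<lambda>v. v \<in> ball z d) (at w within {z. Im z > 0})"
          unfolding eventually_at using w
          by (intro exI[of _ "d - dist w z"]) (smt (verit) dist_triangle dist_commute mem_ball)
        moreover have "eventually (\<lambda>v. v \<in> {z. Im z > 0}) (at w within {z. Im z > 0})"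
          by (auto simp: eventually_at_filter)
        ultimately have "eventually (\<lambda>v. dist (f v) (L x) \<le> e / 2) (at w within {z. Im z > 0})"
        proof eventually_elim
          case (elim v)
          then show ?case
            using d(2)[of v] by (auto simp: complex_is_Real_iff dist_commute)
        qed
        moreover have "((\<lambda>v. dist (f v) (L x)) \<longlongrightarrow> dist (L y) (L x)) (at w within {z. Im z > 0})"
          unfolding y by (intro tendsto_intros up)
        moreover have "at w within {z. Im z > 0} \<noteq> bot"
        proof -
          have "w islimpt {z. Im z > 0}"
          proof (rule islimpt_approachable[THEN iffD2], intro allI impI)
            fix \<epsilon> :: real assume "\<epsilon> > 0"
            then show "\<exists>x'\<in>{z. 0 < Im z}. x' \<noteq> w \<and> dist x' w < \<epsilon>"
              using y by (intro bexI[of _ "w + \<i> * of_real (\<epsilon> / 2)"])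
                (auto simp: dist_norm norm_mult)
          qed
          then show ?thesis
            by (simp add: trivial_limit_within)
        qed
        ultimately have "dist (L y) (L x) \<le> e / 2"
          by (metis tendsto_upperbound)
        then show ?thesis
          using x y \<open>e > 0\<close> by (simp add: g_def)
      qed
      with d(1) show ?thesis by blast
    qed
    then show ?thesis
      by (auto simp: continuous_at_eps_delta)
  qed
  have "g holomorphic_on UNIV"
  proof (rule holomorphic_on_paste_across_line[where d = \<i> and k = 0])
    show "g holomorphic_on (UNIV \<inter> {z. \<i> \<bullet> z < 0})"
      by (rule holomorphic_transform[OF holomorphic_on_subset[OF hol]])
        (auto simp: g_def complex_is_Real_iff)
    show "g holomorphic_on (UNIV \<inter> {z. 0 < \<i> \<bullet> z})"
      by (rule holomorphic_transform[OF holomorphic_on_subset[OF hol]])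
        (auto simp: g_def complex_is_Real_iff)
  qed (auto simp: cont continuous_at_imp_continuous_on)
  then show thesis
    by (rule that) (auto simp: g_def)
qed

text \<open>
  A version of Liouville's theorem that tolerates a simple blow-up at the real line. On the circle
  \<open>|z| = r\<close> one has \<open>|z\<^sup>2 - r\<^sup>2| = 2 r |Im z|\<close>, so multiplying by \<open>z\<^sup>2 - r\<^sup>2\<close> cancels
  the blow-up, and the maximum principle carries the resulting bound to the circle of radius \<open>r/2\<close>.
\<close>

lemma entire_linear_if_growth_off_real_line:
  assumes hol: "g holomorphic_on UNIV"
    and bound: "\<And>z. \<lbrakk>z \<notin> \<real>; \<rho> \<le> norm z\<rbrakk> \<Longrightarrow> norm (g z) \<le> B * (norm z + 1 / \<bar>Im z\<bar>)"
  obtains \<alpha> \<beta> where "\<And>z. g z = \<alpha> * z + \<beta>"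
proof -
  define s where "s = max \<rho> 1"
  have "s > 0" "\<rho> \<le> s"
    by (auto simp: s_def)
  have "0 \<le> B * (s + 1 / s)"
    using \<open>s > 0\<close> bound[of "\<i> * of_real s"] \<open>\<rho> \<le> s\<close> norm_ge_zero[of "g (\<i> * of_real s)"]
    by (auto simp: complex_is_Real_iff norm_mult simp del: norm_ge_zero)
  moreover have "s + 1 / s > 0"
    by (auto simp: s_def intro!: add_pos_pos)
  ultimately have B: "B \<ge> 0"
    by (simp add: zero_le_mult_iff)
  have "norm (g w) \<le> (32 / 3 * B) * norm w ^ 1" if w: "s \<le> norm w" for w
  proof -
    define r where "r = 2 * norm w"
    have r: "r \<ge> 1" "r \<ge> \<rho>" "norm w < r"
      using w by (auto simp: r_def s_def)
    have "norm (g w * (w\<^sup>2 - of_real (r\<^sup>2))) \<le> 4 * B * r ^ 3"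
    proof (rule maximum_modulus_frontier[where f = "\<lambda>z. g z * (z\<^sup>2 - of_real (r\<^sup>2))" and S = "ball 0 r"])
      show "(\<lambda>z. g z * (z\<^sup>2 - of_real (r\<^sup>2))) holomorphic_on interior (ball 0 r)"
        by (intro holomorphic_intros holomorphic_on_subset[OF hol]) auto
      show "continuous_on (closure (ball 0 r)) (\<lambda>z. g z * (z\<^sup>2 - of_real (r\<^sup>2)))"
        by (intro continuous_intros continuous_on_subset[OF holomorphic_on_imp_continuous_on[OF hol]]) auto
      show "norm (g z * (z\<^sup>2 - of_real (r\<^sup>2))) \<le> 4 * B * r ^ 3" if "z \<in> frontier (ball 0 r)" for z
      proof -
        have nz: "norm z = r"
          using that r by simp
        show ?thesis
        proof (cases "z \<in> \<real>")
          case True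
          then have "z\<^sup>2 = of_real (r\<^sup>2)"
            using nz by (auto elim!: Reals_cases simp flip: of_real_power)
          then show ?thesis using B r by simp
        next
          case False
          then have Im: "Im z \<noteq> 0"
            by (simp add: complex_is_Real_iff)
          have "z\<^sup>2 - of_real (r\<^sup>2) = z * (2 * \<i> * of_real (Im z))"
          proof -
            have "of_real (r\<^sup>2) = z * cnj z"
              using nz complex_norm_square[of z] by simp
            moreover have "z - cnj z = 2 * \<i> * of_real (Im z)"
              by (simp add: complex_eq_iff)
            ultimately show ?thesis
              by (metis power2_eq_square right_diff_distrib)
          qed
          then have "norm (g z * (z\<^sup>2 - of_real (r\<^sup>2))) = norm (g z) * (2 * r * \<bar>Im z\<bar>)"
            using nz by (simp add: norm_mult)
          also have "\<dots> \<le> (B * (r + 1 / \<bar>Im z\<bar>)) * (2 * r * \<bar>Im z\<bar>)"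
            using bound[OF False] nz r by (intro mult_right_mono) auto
          also have "\<dots> = B * (2 * r * (r * \<bar>Im z\<bar> + 1))"
            using Im by (simp add: field_simps)
          also have "\<dots> \<le> B * (4 * r ^ 3)"
          proof (intro mult_left_mono B)
            have "r * \<bar>Im z\<bar> + 1 \<le> r * r + r * r"
              using abs_Im_le_cmod[of z] nz r mult_mono[of 1 r 1 r]
              by (intro add_mono mult_left_mono) auto
            then have "2 * r * (r * \<bar>Im z\<bar> + 1) \<le> 2 * r * (r * r + r * r)"
              using r by (intro mult_left_mono) auto
            then show "2 * r * (r * \<bar>Im z\<bar> + 1) \<le> 4 * r ^ 3"
              by (simp add: power3_eq_cube)
          qed
          finally show ?thesis by simp
        qed
      qed
    qed (use r in auto)
    moreover have "norm (w\<^sup>2 - of_real (r\<^sup>2)) \<ge> 3 * (norm w)\<^sup>2"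
      using norm_triangle_ineq2[of "of_real (r\<^sup>2) :: complex" "w\<^sup>2"]
      by (simp add: norm_power norm_minus_commute r_def power_mult_distrib norm_mult)
    ultimately have "norm (g w) * (3 * (norm w)\<^sup>2) \<le> 4 * B * (2 * norm w) ^ 3"
      unfolding r_def norm_mult by (meson mult_left_mono norm_ge_zero order_trans)
    then have "norm (g w) * (norm w)\<^sup>2 \<le> (32 / 3 * B * norm w) * (norm w)\<^sup>2"
      by (simp add: power2_eq_square power3_eq_cube algebra_simps)
    moreover have "(norm w)\<^sup>2 > 0"
      using w by (auto simp: s_def)
    ultimately show ?thesis
      by (simp only: mult_le_cancel_right_pos power_one_right)
  qed
  then have "g z = (\<Sum>k\<le>1. (deriv ^^ k) g 0 / fact k * z ^ k)" for z
    by (rule Liouville_polynomial[OF hol])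
  moreover have "(\<Sum>k\<le>1. (deriv ^^ k) g 0 / fact k * z ^ k) = deriv g 0 * z + g 0" for z
    by simp
  ultimately show thesis
    by (metis that)
qed

section \<open>Limits along the positive imaginary axis\<close>

text \<open>
  On this ray \<open>|Im z| = |z|\<close>, so Cauchy's estimate on a disc of radius \<open>|Im z| / 2\<close> gains a full power
  of \<open>z\<close>, and asymptotic expansions may be differentiated term by term.
\<close>

definition upward :: "complex filter" where
  "upward = filtermap (\<lambda>y. \<i> * of_real y) at_top"

lemma upward_neq_bot [simp]: "upward \<noteq> bot"
  by (simp add: upward_def filtermap_bot_iff)

lemma eventually_upward: "eventually (\<lambda>z. z \<noteq> 0 \<and> z \<notin> \<real> \<and> r \<le> norm z \<and> \<bar>Im z\<bar> = norm z) upward"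
  unfolding upward_def eventually_filtermap
  using eventually_ge_at_top[of "max r 1"]
  by eventually_elim (auto simp: complex_is_Real_iff norm_mult)

lemma filterlim_upward: "filterlim (\<lambda>z. z) at_infinity upward"
  unfolding upward_def filterlim_filtermap
  by (rule tendsto_mult_filterlim_at_infinity[OF tendsto_const _ filterlim_of_real_at_infinity]) simp

lemma tendsto_divide_upward: "((\<lambda>z. w / z) \<longlongrightarrow> 0) upward"
  by (intro tendsto_divide_0[OF tendsto_const] filterlim_upward)

lemma linear_tendsto_upward:
  assumes "((\<lambda>z. \<alpha> * z + \<beta>) \<longlongrightarrow> l) upward"
  shows "\<alpha> = 0" "\<beta> = l"
proof -
  have "((\<lambda>z. (\<alpha> * z + \<beta>) * (1 / z) - \<beta> / z) \<longlongrightarrow> l * 0 - 0) upward"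
    by (intro tendsto_intros assms tendsto_divide_upward)
  moreover have "eventually (\<lambda>z. (\<alpha> * z + \<beta>) * (1 / z) - \<beta> / z = \<alpha>) upward"
    using eventually_upward[of 1] by eventually_elim (auto simp: field_simps)
  ultimately have "((\<lambda>z. \<alpha>) \<longlongrightarrow> l * 0 - 0) upward"
    by (rule Lim_transform_eventually)
  then show "\<alpha> = 0"
    by (simp add: tendsto_const_iff)
  with assms show "\<beta> = l"
    by (simp add: tendsto_const_iff)
qed

section \<open>Riemann--Hilbert problems with Gaussian weights\<close>

text \<open>
  The setting of the argument: the jump of \<open>Y\<close> becomes the constant matrix \<open>C\<close> after multiplication
  by the diagonal matrix of the Gaussians \<open>exp (p\<^sub>k z\<^sup>2 / 2 + q\<^sub>k z)\<close>, and \<open>F\<close> is \<open>Y\<close> stripped of its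
  powers at infinity. The remainder of the expansion \<open>F = I + c / z + O(1 / z\<^sup>2)\<close> carries explicit
  constants because it has to be uniform up to the real line.
\<close>

locale gaussian_RH_problem =
  fixes p q :: "'n::finite \<Rightarrow> complex" and \<nu> :: "'n \<Rightarrow> int" and C :: "complex^'n^'n"
    and Y F :: "complex \<Rightarrow> complex^'n^'n" and c :: "complex^'n^'n" and \<rho> K :: real
  assumes Y_holomorphic: "\<And>i j. (\<lambda>z. Y z $ i $ j) holomorphic_on - \<real>"
    and jump: "\<And>x::real. \<exists>Yp Ym.
      (Y \<longlongrightarrow> Yp) (at (complex_of_real x) within {z. Im z > 0}) \<and>
      (Y \<longlongrightarrow> Ym) (at (complex_of_real x) within {z. Im z < 0}) \<and>
      Yp ** diag (\<lambda>k. exp (p k * (of_real x)\<^sup>2 / 2 + q k * of_real x)) =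
      Ym ** diag (\<lambda>k. exp (p k * (of_real x)\<^sup>2 / 2 + q k * of_real x)) ** C"
    and det_C: "det C = 1"
    and sum_\<nu>: "(\<Sum>k\<in>UNIV. \<nu> k) = 0"
    and Y_eq: "\<And>z. z \<notin> \<real> \<Longrightarrow> Y z = F z ** diag (\<lambda>k. z powi \<nu> k)"
    and \<rho>_ge_1: "1 \<le> \<rho>"
    and F_expansion: "\<And>z i j. \<lbrakk>z \<notin> \<real>; \<rho> \<le> norm z\<rbrakk> \<Longrightarrow>
      norm (F z $ i $ j - mat 1 $ i $ j - c $ i $ j / z) \<le> K / (norm z)\<^sup>2"
begin

definition gauss :: "'n \<Rightarrow> complex \<Rightarrow> complex" where
  "gauss k z = exp (p k * z\<^sup>2 / 2 + q k * z)"

text \<open>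
  \<open>F H S\<close>, with \<open>H\<close> the diagonal matrix of the \<open>h k\<close>, is the frame without jump. The logarithmic
  derivative of \<open>h k\<close> is \<open>\<kappa> k\<close>.
\<close>

definition h :: "'n \<Rightarrow> complex \<Rightarrow> complex" where
  "h k z = z powi \<nu> k * gauss k z"

definition \<kappa> :: "'n \<Rightarrow> complex \<Rightarrow> complex" where
  "\<kappa> k z = of_int (\<nu> k) / z + p k * z + q k"

text \<open>
  In the lower half plane the frame is multiplied by the constant jump, so that its two boundary
  values agree.
\<close>

definition S :: "complex \<Rightarrow> complex^'n^'n" where
  "S z = (if Im z > 0 then mat 1 else C)"

lemma h_nonzero: "z \<notin> \<real> \<Longrightarrow> h k z \<noteq> 0"
  by (auto simp: h_def gauss_def)

lemma h_has_field_derivative: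
  assumes "z \<notin> \<real>"
  shows "(h k has_field_derivative h k z * \<kappa> k z) (at z)"
proof -
  have "z \<noteq> 0"
    using assms by auto
  have "(h k has_field_derivative
      of_int (\<nu> k) * z powi (\<nu> k - 1) * gauss k z + z powi \<nu> k * (gauss k z * (p k * z + q k))) (at z)"
    unfolding h_def[abs_def] gauss_def
    using \<open>z \<noteq> 0\<close> by (auto intro!: derivative_eq_intros)
  then show ?thesis
    using \<open>z \<noteq> 0\<close> by (simp add: h_def \<kappa>_def power_int_diff field_simps)
qed

lemma det_S: "det (S z) = 1"
  by (simp add: S_def det_C)

lemma F_holomorphic: "(\<lambda>z. F z $ i $ j) holomorphic_on - \<real>"
proof -
  have "(\<lambda>z. Y z $ i $ j * z powi (- \<nu> j)) holomorphic_on - \<real>"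
    by (intro holomorphic_intros Y_holomorphic) auto
  then show ?thesis
  proof (rule holomorphic_transform)
    fix z :: complex assume "z \<in> - \<real>"
    then show "Y z $ i $ j * z powi (- \<nu> j) = F z $ i $ j"
      by (cases "z = 0") (auto simp: Y_eq matrix_mult_diag power_int_minus)
  qed
qed

lemma open_off_real: "open (- (\<real> :: complex set))"
  using closed_complex_Reals by (simp add: open_Compl)

lemma F_has_field_derivative:
  assumes "z \<notin> \<real>"
  shows "((\<lambda>w. F w $ i $ j) has_field_derivative deriv (\<lambda>w. F w $ i $ j) z) (at z)"
  using holomorphic_derivI[OF F_holomorphic open_off_real] assms by simp

text \<open>
  The frame \<open>Y G S\<close>, with \<open>G\<close> the diagonal matrix of the Gaussians, has equal limits from both
  sides of the line, by the jump condition, and therefore extends to an entire matrix.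
\<close>

lemma entire_frame:
  obtains X where "\<And>i j. (\<lambda>z. X z $ i $ j) holomorphic_on UNIV"
    and "\<And>z. z \<notin> \<real> \<Longrightarrow> X z = F z ** diag (\<lambda>k. h k z) ** S z"
proof -
  define \<Psi> where "\<Psi> z = Y z ** diag (\<lambda>k. gauss k z) ** S z" for z
  have \<Psi>_entry: "\<Psi> z $ i $ j = (\<Sum>k\<in>UNIV. Y z $ i $ k * gauss k z * S z $ k $ j)" for z i j
    unfolding \<Psi>_def matrix_matrix_mult_def[of "Y z ** _"] by (simp add: matrix_mult_diag)
  have gauss_hol: "gauss k holomorphic_on A" for k A
    unfolding gauss_def[abs_def] by (intro holomorphic_intros) auto
  have halves: "- \<real> = {z. Im z > 0} \<union> {z. Im z < 0}"
    by (auto simp: complex_is_Real_iff)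
  have S_hol: "(\<lambda>z. S z $ k $ j) holomorphic_on - \<real>" for k j
    unfolding halves
  proof (rule holomorphic_on_Un)
    show "(\<lambda>z. S z $ k $ j) holomorphic_on {z. Im z > 0}"
      by (rule holomorphic_transform[of "\<lambda>z. mat 1 $ k $ j"]) (auto simp: S_def)
    show "(\<lambda>z. S z $ k $ j) holomorphic_on {z. Im z < 0}"
      by (rule holomorphic_transform[of "\<lambda>z. C $ k $ j"]) (auto simp: S_def)
  qed (auto simp: open_halfspace_Im_gt open_halfspace_Im_lt)
  have "\<exists>g. g holomorphic_on UNIV \<and> (\<forall>z. z \<notin> \<real> \<longrightarrow> g z = \<Psi> z $ i $ j)" for i j
  proof (rule holomorphic_extension_across_real_line[of "\<lambda>z. \<Psi> z $ i $ j"])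
    show "(\<lambda>z. \<Psi> z $ i $ j) holomorphic_on - \<real>"
      unfolding \<Psi>_entry by (intro holomorphic_intros Y_holomorphic gauss_hol S_hol)
    fix x :: real
    let ?x = "complex_of_real x"
    obtain Yp Ym where Yp: "(Y \<longlongrightarrow> Yp) (at ?x within {z. Im z > 0})"
      and Ym: "(Y \<longlongrightarrow> Ym) (at ?x within {z. Im z < 0})"
      and eq: "Yp ** diag (\<lambda>k. gauss k ?x) = Ym ** diag (\<lambda>k. gauss k ?x) ** C"
      using jump[of x] unfolding gauss_def by blast
    have gauss_lim: "(gauss k \<longlongrightarrow> gauss k ?x) (at ?x within A)" for k A
      using holomorphic_on_imp_continuous_on[OF gauss_hol[of k UNIV]]
      by (auto simp: continuous_on_eq_continuous_at isCont_def intro: tendsto_within_subset)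
    define L where "L = (Yp ** diag (\<lambda>k. gauss k ?x)) $ i $ j"
    have "((\<lambda>z. \<Sum>k\<in>UNIV. Y z $ i $ k * gauss k z * mat 1 $ k $ j) \<longlongrightarrow>
        (\<Sum>k\<in>UNIV. Yp $ i $ k * gauss k ?x * mat 1 $ k $ j)) (at ?x within {z. Im z > 0})"
      by (intro tendsto_intros Yp gauss_lim)
    also have "(\<Sum>k\<in>UNIV. Yp $ i $ k * gauss k ?x * mat 1 $ k $ j) = L"
      by (simp add: L_def matrix_mult_diag mat_def if_distrib cong: if_cong)
    finally have up: "((\<lambda>z. \<Psi> z $ i $ j) \<longlongrightarrow> L) (at ?x within {z. Im z > 0})"
      by (rule Lim_transform_eventually) (auto simp: eventually_at_filter \<Psi>_entry S_def)
    have "((\<lambda>z. \<Sum>k\<in>UNIV. Y z $ i $ k * gauss k z * C $ k $ j) \<longlongrightarrow>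
        (\<Sum>k\<in>UNIV. Ym $ i $ k * gauss k ?x * C $ k $ j)) (at ?x within {z. Im z < 0})"
      by (intro tendsto_intros Ym gauss_lim)
    also have "(\<Sum>k\<in>UNIV. Ym $ i $ k * gauss k ?x * C $ k $ j) = L"
      unfolding L_def eq matrix_matrix_mult_def[of "Ym ** _"] by (simp add: matrix_mult_diag)
    finally have down: "((\<lambda>z. \<Psi> z $ i $ j) \<longlongrightarrow> L) (at ?x within {z. Im z < 0})"
      by (rule Lim_transform_eventually) (auto simp: eventually_at_filter \<Psi>_entry S_def)
    show "\<exists>L. ((\<lambda>z. \<Psi> z $ i $ j) \<longlongrightarrow> L) (at ?x within {z. Im z > 0}) \<and>
        ((\<lambda>z. \<Psi> z $ i $ j) \<longlongrightarrow> L) (at ?x within {z. Im z < 0})"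
      using up down by blast
  qed blast
  then obtain x where x: "\<And>i j. x i j holomorphic_on UNIV"
      "\<And>i j z. z \<notin> \<real> \<Longrightarrow> x i j z = \<Psi> z $ i $ j"
    by metis
  show thesis
  proof (rule that[of "\<lambda>z. \<chi> i j. x i j z"])
    show "(\<lambda>z. (\<chi> i j. x i j z) $ i $ j) holomorphic_on UNIV" for i j
      by (simp add: x)
    fix z :: complex assume z: "z \<notin> \<real>"
    have "Y z ** diag (\<lambda>k. gauss k z) = F z ** diag (\<lambda>k. h k z)"
      by (simp add: vec_eq_iff matrix_mult_diag Y_eq z h_def mult_ac)
    then show "(\<chi> i j. x i j z) = F z ** diag (\<lambda>k. h k z) ** S z"
      by (simp add: x(2)[OF z] \<Psi>_def)
  qed
qed

definition F_bound :: real where "F_bound = 1 + K + (\<Sum>i\<in>UNIV. \<Sum>j\<in>UNIV. norm (c $ i $ j))"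

lemma norm_c_le: "norm (c $ i $ j) \<le> (\<Sum>i\<in>UNIV. \<Sum>j\<in>UNIV. norm (c $ i $ j))"
proof -
  have "norm (c $ i $ j) \<le> (\<Sum>j\<in>UNIV. norm (c $ i $ j))"
    by (rule member_le_sum) auto
  also have "\<dots> \<le> (\<Sum>i\<in>UNIV. \<Sum>j\<in>UNIV. norm (c $ i $ j))"
    by (rule member_le_sum) (auto intro: sum_nonneg)
  finally show ?thesis .
qed

lemma K_nonneg: "0 \<le> K"
proof -
  have "0 \<le> K / \<rho>\<^sup>2"
    using F_expansion[of "\<i> * of_real \<rho>" undefined undefined] \<rho>_ge_1
    by (auto simp: complex_is_Real_iff norm_mult intro: order_trans[OF norm_ge_zero])
  then show ?thesis
    using \<rho>_ge_1 by (auto simp: zero_le_divide_iff)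
qed

lemma F_bound_ge_1: "1 \<le> F_bound"
  unfolding F_bound_def using K_nonneg by (simp add: sum_nonneg)

lemma norm_F_le:
  assumes "z \<notin> \<real>" "\<rho> \<le> norm z"
  shows "norm (F z $ i $ j) \<le> F_bound"
proof -
  have z: "1 \<le> norm z"
    using assms \<rho>_ge_1 by simp
  have "norm (F z $ i $ j) \<le>
      norm (F z $ i $ j - mat 1 $ i $ j - c $ i $ j / z) + norm (mat 1 $ i $ j + c $ i $ j / z)"
    using norm_triangle_ineq[of "F z $ i $ j - mat 1 $ i $ j - c $ i $ j / z" "mat 1 $ i $ j + c $ i $ j / z"]
    by (simp add: algebra_simps)
  moreover have "norm (mat 1 $ i $ j + c $ i $ j / z) \<le> 1 + norm (c $ i $ j)"
  proof (intro order_trans[OF norm_triangle_ineq] add_mono)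
    show "norm (mat 1 $ i $ j :: complex) \<le> 1"
      by (simp add: mat_def)
    show "norm (c $ i $ j / z) \<le> norm (c $ i $ j)"
      using z frac_le[of "norm (c $ i $ j)" "norm (c $ i $ j)" 1 "norm z"] by (simp add: norm_divide)
  qed
  moreover have "K / (norm z)\<^sup>2 \<le> K"
    using z K_nonneg frac_le[of K K 1 "(norm z)\<^sup>2"] by simp
  ultimately show ?thesis
    using F_expansion[OF assms, of i j] norm_c_le[of i j] by (simp add: F_bound_def)
qed

lemma F_tendsto_coefficient:
  "((\<lambda>z. z * (F z $ i $ j - mat 1 $ i $ j)) \<longlongrightarrow> c $ i $ j) upward"
proof (rule Lim_null[THEN iffD2], rule Lim_null_comparison)
  show "eventually (\<lambda>z. norm (z * (F z $ i $ j - mat 1 $ i $ j) - c $ i $ j) \<le> norm (of_real K / z)) upward"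
    using eventually_upward[of \<rho>]
  proof eventually_elim
    case (elim z)
    then have z: "z \<noteq> 0"
      by auto
    have "z * (F z $ i $ j - mat 1 $ i $ j) - c $ i $ j = z * (F z $ i $ j - mat 1 $ i $ j - c $ i $ j / z)"
      using z by (simp add: field_simps)
    also have "norm \<dots> \<le> norm z * (K / (norm z)\<^sup>2)"
      unfolding norm_mult using elim by (intro mult_left_mono F_expansion) auto
    finally show ?case
      using z K_nonneg by (simp add: norm_divide power2_eq_square)
  qed
  show "((\<lambda>z. norm (of_real K / z)) \<longlongrightarrow> 0) upward"
    using tendsto_norm[OF tendsto_divide_upward] by simp
qed

lemma F_tendsto: "((\<lambda>z. F z $ i $ j) \<longlongrightarrow> mat 1 $ i $ j) upward"
proof (rule Lim_null[THEN iffD2], rule Lim_transform_eventually)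
  show "((\<lambda>z. z * (F z $ i $ j - mat 1 $ i $ j) * (1 / z)) \<longlongrightarrow> 0) upward"
    using tendsto_mult[OF F_tendsto_coefficient tendsto_divide_upward[of 1]]
    by (simp only: mult_zero_right)
  show "eventually (\<lambda>z. z * (F z $ i $ j - mat 1 $ i $ j) * (1 / z) = F z $ i $ j - mat 1 $ i $ j) upward"
    using eventually_upward[of 1] by eventually_elim auto
qed

text \<open>
  Cauchy's estimate for the remainder on the disc of radius \<open>|Im z| / 2\<close>, which stays off the real
  line. This is where a factor \<open>1 / |Im z|\<close> enters.
\<close>

lemma norm_deriv_F_le:
  assumes z: "z \<notin> \<real>" "2 * \<rho> \<le> norm z"
  shows "norm (deriv (\<lambda>w. F w $ i $ j) z) \<le> (norm (c $ i $ j) + 8 * K / \<bar>Im z\<bar>) / (norm z)\<^sup>2"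
proof -
  define R where "R w = F w $ i $ j - mat 1 $ i $ j - c $ i $ j / w" for w
  define r where "r = \<bar>Im z\<bar> / 2"
  have r: "r > 0"
    using z by (simp add: r_def complex_is_Real_iff)
  have disc: "w \<notin> \<real> \<and> norm z / 2 \<le> norm w" if "norm (z - w) \<le> r" for w
  proof -
    have "\<bar>Im z - Im w\<bar> \<le> r"
      using that abs_Im_le_cmod[of "z - w"] by simp
    moreover have "norm z \<le> norm (z - w) + norm w"
      by (metis diff_add_cancel norm_triangle_ineq)
    ultimately show ?thesis
      using that r abs_Im_le_cmod[of z] by (auto simp: complex_is_Real_iff r_def)
  qed
  have R_hol: "R holomorphic_on - \<real>"
    unfolding R_def[abs_def] by (intro holomorphic_intros F_holomorphic) auto
  have "norm ((deriv ^^ 1) R z) \<le> fact 1 * (4 * K / (norm z)\<^sup>2) / r ^ 1"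
  proof (rule Cauchy_inequality)
    show "R holomorphic_on ball z r"
      by (rule holomorphic_on_subset[OF R_hol]) (use disc in \<open>auto simp: dist_norm\<close>)
    show "continuous_on (cball z r) R"
      by (rule continuous_on_subset[OF holomorphic_on_imp_continuous_on[OF R_hol]])
        (use disc in \<open>auto simp: dist_norm\<close>)
    fix w assume "norm (z - w) = r"
    then have w: "w \<notin> \<real>" "norm z / 2 \<le> norm w"
      using disc[of w] by auto
    have "norm (R w) \<le> K / (norm w)\<^sup>2"
      unfolding R_def using w z by (intro F_expansion) auto
    also have "\<dots> \<le> K / (norm z / 2)\<^sup>2"
      using w z \<rho>_ge_1 K_nonneg by (intro divide_left_mono power_mono mult_pos_pos zero_less_power) auto
    finally show "norm (R w) \<le> 4 * K / (norm z)\<^sup>2"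
      by (simp add: power_divide mult.commute)
  qed (use r in auto)
  then have "norm (deriv R z) \<le> (8 * K / \<bar>Im z\<bar>) / (norm z)\<^sup>2"
    by (simp add: r_def field_simps)
  moreover have "deriv R z = deriv (\<lambda>w. F w $ i $ j) z + c $ i $ j / z\<^sup>2"
    unfolding R_def[abs_def] using z
    by (intro DERIV_imp_deriv)
      (auto intro!: derivative_eq_intros F_has_field_derivative simp: power2_eq_square)
  moreover have "norm (c $ i $ j / z\<^sup>2) = norm (c $ i $ j) / (norm z)\<^sup>2"
    by (simp add: norm_divide norm_power)
  moreover have "norm (deriv (\<lambda>w. F w $ i $ j) z) \<le>
      norm (deriv (\<lambda>w. F w $ i $ j) z + c $ i $ j / z\<^sup>2) + norm (c $ i $ j / z\<^sup>2)"
    using norm_triangle_ineq4[of "deriv (\<lambda>w. F w $ i $ j) z + c $ i $ j / z\<^sup>2" "c $ i $ j / z\<^sup>2"] by simp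
  ultimately show ?thesis
    by (simp add: add_divide_distrib)
qed

lemma deriv_F_tendsto: "((\<lambda>z. z * deriv (\<lambda>w. F w $ i $ j) z) \<longlongrightarrow> 0) upward"
proof (rule Lim_null_comparison)
  show "eventually (\<lambda>z. norm (z * deriv (\<lambda>w. F w $ i $ j) z) \<le>
      norm (of_real (norm (c $ i $ j) + 8 * K) / z)) upward"
    using eventually_upward[of "2 * \<rho>"]
  proof eventually_elim
    case (elim z)
    then have z: "1 \<le> norm z"
      using \<rho>_ge_1 by linarith
    have "norm (z * deriv (\<lambda>w. F w $ i $ j) z) \<le>
        norm z * ((norm (c $ i $ j) + 8 * K / \<bar>Im z\<bar>) / (norm z)\<^sup>2)"
      unfolding norm_mult using elim by (intro mult_left_mono norm_deriv_F_le) auto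
    also have "\<dots> = (norm (c $ i $ j) + 8 * K / \<bar>Im z\<bar>) / norm z"
      using z by (auto simp: power2_eq_square)
    also have "\<dots> \<le> (norm (c $ i $ j) + 8 * K) / norm z"
      using z elim K_nonneg frac_le[of "8 * K" "8 * K" 1 "norm z"]
      by (intro divide_right_mono) auto
    also have "\<dots> = norm (of_real (norm (c $ i $ j) + 8 * K) / z)"
      using K_nonneg by (simp add: norm_divide del: of_real_add)
    finally show ?case .
  qed
  show "((\<lambda>z. norm (of_real (norm (c $ i $ j) + 8 * K) / z)) \<longlongrightarrow> 0) upward"
    using tendsto_norm[OF tendsto_divide_upward] by simp
qed

lemma norm_det_F_le:
  assumes "z \<notin> \<real>" "\<rho> \<le> norm z"
  shows "norm (det (F z)) \<le> fact CARD('n) * F_bound ^ CARD('n)"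
  by (intro norm_det_le norm_F_le assms)

lemma det_F_tendsto: "((\<lambda>z. det (F z)) \<longlongrightarrow> 1) upward"
  using det_tendsto[of F "mat 1" upward] F_tendsto by simp

section \<open>The linear differential equation of the frame\<close>

text \<open>
  \<open>det F\<close> coincides off the line with the entire function \<open>det X / \<Prod> gauss k\<close>, because the jump has
  determinant 1 and the exponents sum to 0. It is bounded and tends to 1 along the imaginary axis,
  hence it is 1.
\<close>

lemma det_frame:
  assumes hol: "\<And>i j. (\<lambda>z. X z $ i $ j) holomorphic_on UNIV"
    and X: "\<And>z. z \<notin> \<real> \<Longrightarrow> X z = F z ** diag (\<lambda>k. h k z) ** S z"
  shows "det (X z) = (\<Prod>k\<in>UNIV. gauss k z)" "z \<notin> \<real> \<Longrightarrow> det (F z) = 1"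
proof -
  define g where "g z = det (X z) / (\<Prod>k\<in>UNIV. gauss k z)" for z
  have nonzero: "(\<Prod>k\<in>UNIV. gauss k z) \<noteq> 0" for z
    by (simp add: gauss_def)
  have prod_hol: "(\<lambda>z. \<Prod>k\<in>UNIV. gauss k z) holomorphic_on UNIV"
    unfolding gauss_def by (intro holomorphic_intros) auto
  have g_hol: "g holomorphic_on UNIV"
    unfolding g_def[abs_def]
    by (rule holomorphic_on_divide[OF det_holomorphic_on[OF hol] prod_hol nonzero])
  have g_F: "g z = det (F z)" if "z \<notin> \<real>" for z
  proof -
    have "z \<noteq> 0"
      using that by auto
    then have "(\<Prod>k\<in>A. z powi \<nu> k) = z powi (\<Sum>k\<in>A. \<nu> k)" for A
      by (induction A rule: infinite_finite_induct) (auto simp: power_int_add)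
    then have "(\<Prod>k\<in>UNIV. h k z) = (\<Prod>k\<in>UNIV. gauss k z)"
      by (simp add: h_def prod.distrib sum_\<nu>)
    then have "det (X z) = det (F z) * (\<Prod>k\<in>UNIV. gauss k z)"
      by (simp add: X[OF that] det_mul det_diag det_S)
    then show ?thesis
      using nonzero by (simp add: g_def)
  qed
  obtain \<alpha> \<beta> where g: "\<And>z. g z = \<alpha> * z + \<beta>"
  proof (rule entire_linear_if_growth_off_real_line[OF g_hol, of \<rho> "fact CARD('n) * F_bound ^ CARD('n)"])
    fix z :: complex assume z: "z \<notin> \<real>" "\<rho> \<le> norm z"
    have "1 \<le> norm z + 1 / \<bar>Im z\<bar>"
      using z \<rho>_ge_1 by (intro add_increasing2) auto
    then have "fact CARD('n) * F_bound ^ CARD('n) * 1 \<le> fact CARD('n) * F_bound ^ CARD('n) * (norm z + 1 / \<bar>Im z\<bar>)"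
      using F_bound_ge_1 by (intro mult_left_mono) auto
    then show "norm (g z) \<le> fact CARD('n) * F_bound ^ CARD('n) * (norm z + 1 / \<bar>Im z\<bar>)"
      unfolding g_F[OF z(1)] mult_1_right by (rule order_trans[OF norm_det_F_le[OF z]])
  qed blast
  have lim: "((\<lambda>z. \<alpha> * z + \<beta>) \<longlongrightarrow> 1) upward"
    using det_F_tendsto
    by (rule Lim_transform_eventually) (use eventually_upward[of 0] in \<open>auto elim!: eventually_mono simp: g_F simp flip: g\<close>)
  have g_1: "g z = 1" for z
    using g linear_tendsto_upward[OF lim] by simp
  then show "det (X z) = (\<Prod>k\<in>UNIV. gauss k z)"
    using nonzero[of z] by (simp add: g_def field_simps)
  show "det (F z) = 1" if "z \<notin> \<real>"
    using g_F[OF that] g_1[of z] by simp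
qed

text \<open>
  \<open>A\<close> is the logarithmic derivative of the entire frame. The locally constant right factor
  \<open>S\<close> drops out of it, so off the real line \<open>A\<close> is also the logarithmic derivative of \<open>F H\<close>; this is
  the stated equation \<open>A F = F' + F \<kappa>\<close>.
\<close>

lemma lax_matrix:
  obtains A where "\<And>i j. (\<lambda>z. A z $ i $ j) holomorphic_on UNIV"
    and "\<And>z i j. z \<notin> \<real> \<Longrightarrow>
      (A z ** F z) $ i $ j = deriv (\<lambda>w. F w $ i $ j) z + F z $ i $ j * \<kappa> j z"
    and "\<And>z. z \<notin> \<real> \<Longrightarrow> det (F z) = 1"
proof -
  obtain X where hol: "\<And>i j. (\<lambda>z. X z $ i $ j) holomorphic_on UNIV"
    and X: "\<And>z. z \<notin> \<real> \<Longrightarrow> X z = F z ** diag (\<lambda>k. h k z) ** S z"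
    by (rule entire_frame) blast
  have det_X: "det (X z) \<noteq> 0" for z
    by (simp add: det_frame(1)[OF hol X] gauss_def)
  define X' where "X' z = (\<chi> i j. deriv (\<lambda>w. X w $ i $ j) z)" for z
  define Xinv where "Xinv z = (\<chi> i j. adjugate (X z) $ i $ j / det (X z))" for z
  define A where "A z = X' z ** Xinv z" for z
  show thesis
  proof (rule that[of A])
    show "(\<lambda>z. A z $ i $ j) holomorphic_on UNIV" for i j
      using det_X unfolding A_def X'_def Xinv_def matrix_matrix_mult_def vec_lambda_beta
      by (intro holomorphic_intros adjugate_holomorphic_on det_holomorphic_on hol) auto
    show "det (F z) = 1" if "z \<notin> \<real>" for z
      using det_frame(2)[OF hol X that] .
    fix z :: complex and i j assume z: "z \<notin> \<real>"
    define H where "H = diag (\<lambda>k. h k z) ** S z"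
    define DF where "DF = (\<chi> i j. deriv (\<lambda>w. F w $ i $ j) z + F z $ i $ j * \<kappa> j z)"
    have "Xinv z ** X z = mat 1"
      using matrix_mult_adjugate[OF det_X] matrix_left_right_inverse
      unfolding Xinv_def by blast
    then have "A z ** X z = X' z"
      by (simp add: A_def flip: matrix_mul_assoc)
    then have "A z ** F z ** H = X' z"
      by (simp add: X[OF z] H_def matrix_mul_assoc)
    also have "X' z = DF ** H"
    proof -
      have "X' z $ i $ j = (DF ** H) $ i $ j" for i j
      proof -
        \<comment> \<open>An open neighbourhood of \<open>z\<close> on which \<open>S\<close> is constant.\<close>
        define U where "U = (if Im z > 0 then {w. Im w > 0} else {w. Im w < 0})"
        have U: "open U" "z \<in> U"
          using z by (auto simp: U_def open_halfspace_Im_gt open_halfspace_Im_lt complex_is_Real_iff)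
        have X_eq: "(\<Sum>k\<in>UNIV. F w $ i $ k * h k w * S z $ k $ j) = X w $ i $ j" if "w \<in> U" for w
        proof -
          have "w \<notin> \<real>" "S w = S z"
            using that z by (auto simp: U_def S_def complex_is_Real_iff split: if_splits)
          then show ?thesis
            by (simp add: X matrix_matrix_mult_def[of "F w ** _"] matrix_mult_diag)
        qed
        have "((\<lambda>w. \<Sum>k\<in>UNIV. F w $ i $ k * h k w * S z $ k $ j) has_field_derivative
            (\<Sum>k\<in>UNIV. (F z $ i $ k * (h k z * \<kappa> k z) + deriv (\<lambda>w. F w $ i $ k) z * h k z) * S z $ k $ j)) (at z)"
          by (intro DERIV_sum DERIV_cmult_right DERIV_mult' F_has_field_derivative
              h_has_field_derivative z)
        then have "((\<lambda>w. X w $ i $ j) has_field_derivative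
            (\<Sum>k\<in>UNIV. (F z $ i $ k * (h k z * \<kappa> k z) + deriv (\<lambda>w. F w $ i $ k) z * h k z) * S z $ k $ j)) (at z)"
          by (rule has_field_derivative_transform_within_open[OF _ U]) (simp add: X_eq)
        then have "X' z $ i $ j =
            (\<Sum>k\<in>UNIV. (F z $ i $ k * (h k z * \<kappa> k z) + deriv (\<lambda>w. F w $ i $ k) z * h k z) * S z $ k $ j)"
          by (simp add: X'_def DERIV_imp_deriv)
        also have "\<dots> = (DF ** H) $ i $ j"
          unfolding H_def matrix_mul_assoc matrix_matrix_mult_def[of "DF ** _"]
          by (simp add: matrix_mult_diag DF_def algebra_simps)
        finally show ?thesis .
      qed
      then show ?thesis
        by (simp add: vec_eq_iff)
    qed
    finally have eq: "A z ** F z ** H = DF ** H" .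
    have "det H \<noteq> 0"
      using h_nonzero[OF z] by (simp add: H_def det_mul det_diag det_S)
    then obtain H' where "H ** H' = mat 1"
      using invertible_det_nz invertible_right_inverse by blast
    then have "A z ** F z = DF"
      using arg_cong[OF eq, of "\<lambda>M. M ** H'"] by (simp flip: matrix_mul_assoc)
    then show "(A z ** F z) $ i $ j = deriv (\<lambda>w. F w $ i $ j) z + F z $ i $ j * \<kappa> j z"
      by (simp add: DF_def)
  qed
qed

text \<open>
  \<open>A = (F' + F \<kappa>) adj F\<close> grows at most like \<open>|z| + 1 / |Im z|\<close>: the linear part comes from \<open>\<kappa>\<close> and
  the singular one from \<open>F'\<close>. Hence every entry of \<open>A\<close> is a polynomial of degree at most one.
\<close>

lemma lax_matrix_linear:
  obtains \<alpha> \<beta> where "\<And>z i j. z \<notin> \<real> \<Longrightarrow>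
      (\<Sum>k\<in>UNIV. (\<alpha> i k * z + \<beta> i k) * F z $ k $ j) =
      deriv (\<lambda>w. F w $ i $ j) z + F z $ i $ j * \<kappa> j z"
proof -
  obtain A where hol: "\<And>i j. (\<lambda>z. A z $ i $ j) holomorphic_on UNIV"
    and A: "\<And>z i j. z \<notin> \<real> \<Longrightarrow>
      (A z ** F z) $ i $ j = deriv (\<lambda>w. F w $ i $ j) z + F z $ i $ j * \<kappa> j z"
    and det_F: "\<And>z. z \<notin> \<real> \<Longrightarrow> det (F z) = 1"
    by (rule lax_matrix) blast
  have "\<exists>\<alpha> \<beta>. \<forall>z. A z $ i $ j = \<alpha> * z + \<beta>" for i j
  proof -
    define B1 where "B1 k = norm (c $ i $ k) + 8 * K + F_bound * (of_int \<bar>\<nu> k\<bar> + norm (p k) + norm (q k))" for k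
    define B2 where "B2 = fact CARD('n) * F_bound ^ CARD('n)"
    show ?thesis
    proof (rule entire_linear_if_growth_off_real_line[OF hol[of i j],
          where \<rho> = "2 * \<rho>" and B = "\<Sum>k\<in>UNIV. B1 k * B2"])
      fix z :: complex assume z: "z \<notin> \<real>" "2 * \<rho> \<le> norm z"
      define G where "G = norm z + 1 / \<bar>Im z\<bar>"
      have z': "1 \<le> norm z" "\<rho> \<le> norm z"
        using z \<rho>_ge_1 by linarith+
      have Im: "\<bar>Im z\<bar> > 0"
        using z by (simp add: complex_is_Real_iff)
      have G: "1 \<le> G" "norm z \<le> G" "1 / \<bar>Im z\<bar> \<le> G"
        using z' by (auto simp: G_def intro: add_increasing2)
      have "F z ** adjugate (F z) = mat 1"
        using matrix_mult_adjugate[of "F z"] det_F[OF z(1)] by simp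
      then have "A z = A z ** F z ** adjugate (F z)"
        by (simp flip: matrix_mul_assoc)
      then have "A z $ i $ j = (A z ** F z ** adjugate (F z)) $ i $ j"
        by simp
      also have "\<dots> = (\<Sum>k\<in>UNIV. (deriv (\<lambda>w. F w $ i $ k) z + F z $ i $ k * \<kappa> k z) * adjugate (F z) $ k $ j)"
        unfolding matrix_matrix_mult_def[of "A z ** F z"] by (simp add: A[OF z(1)])
      also have "norm \<dots> \<le> (\<Sum>k\<in>UNIV. B1 k * G * B2)"
      proof (intro sum_norm_le)
        fix k
        have "norm (deriv (\<lambda>w. F w $ i $ k) z) \<le> (norm (c $ i $ k) + 8 * K) * G"
        proof -
          have "norm (deriv (\<lambda>w. F w $ i $ k) z) \<le> (norm (c $ i $ k) + 8 * K / \<bar>Im z\<bar>) / (norm z)\<^sup>2"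
            by (rule norm_deriv_F_le[OF z])
          also have "\<dots> \<le> (norm (c $ i $ k) + 8 * K / \<bar>Im z\<bar>) / 1"
            using z' K_nonneg by (intro divide_left_mono add_nonneg_nonneg) auto
          also have "\<dots> \<le> norm (c $ i $ k) * G + 8 * K * G"
            using G K_nonneg mult_left_mono[OF G(3), of "8 * K"] mult_left_mono[OF G(1), of "norm (c $ i $ k)"]
            by simp
          finally show ?thesis
            by (simp add: algebra_simps)
        qed
        moreover have "norm (F z $ i $ k * \<kappa> k z) \<le> F_bound * ((of_int \<bar>\<nu> k\<bar> + norm (p k) + norm (q k)) * G)"
          unfolding norm_mult
        proof (intro mult_mono norm_F_le z z')
          have "norm (\<kappa> k z) \<le> of_int \<bar>\<nu> k\<bar> / norm z + norm (p k) * norm z + norm (q k)"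
            unfolding \<kappa>_def by (intro order_trans[OF norm_triangle_ineq] add_mono)
              (auto simp: norm_divide norm_mult)
          also have "\<dots> \<le> of_int \<bar>\<nu> k\<bar> * G + norm (p k) * G + norm (q k) * G"
          proof (intro add_mono mult_left_mono)
            have "of_int \<bar>\<nu> k\<bar> / norm z \<le> of_int \<bar>\<nu> k\<bar> / (1 :: real)"
              using z' by (intro divide_left_mono) auto
            also have "\<dots> \<le> of_int \<bar>\<nu> k\<bar> * G"
              using G mult_left_mono[OF G(1), of "of_int \<bar>\<nu> k\<bar>"] by simp
            finally show "of_int \<bar>\<nu> k\<bar> / norm z \<le> of_int \<bar>\<nu> k\<bar> * G" .
            show "norm (q k) \<le> norm (q k) * G"
              using mult_left_mono[OF G(1), of "norm (q k)"] by simp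
          qed (use G in auto)
          finally show "norm (\<kappa> k z) \<le> (of_int \<bar>\<nu> k\<bar> + norm (p k) + norm (q k)) * G"
            by (simp add: algebra_simps)
        qed (use F_bound_ge_1 in auto)
        ultimately have "norm (deriv (\<lambda>w. F w $ i $ k) z + F z $ i $ k * \<kappa> k z) \<le> B1 k * G"
          using norm_triangle_ineq[of "deriv (\<lambda>w. F w $ i $ k) z" "F z $ i $ k * \<kappa> k z"]
          by (simp add: B1_def algebra_simps)
        moreover have "norm (adjugate (F z) $ k $ j) \<le> B2"
          unfolding B2_def by (intro norm_adjugate_le norm_F_le z z' F_bound_ge_1)
        ultimately show "norm ((deriv (\<lambda>w. F w $ i $ k) z + F z $ i $ k * \<kappa> k z) * adjugate (F z) $ k $ j) \<le> B1 k * G * B2"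
          unfolding norm_mult by (rule mult_mono') auto
      qed
      finally show "norm (A z $ i $ j) \<le> (\<Sum>k\<in>UNIV. B1 k * B2) * (norm z + 1 / \<bar>Im z\<bar>)"
        by (simp add: G_def sum_distrib_right mult_ac)
    qed blast
  qed
  then obtain \<alpha> \<beta> where "\<And>i j z. A z $ i $ j = \<alpha> i j * z + \<beta> i j"
    by metis
  then show thesis
    using A by (intro that[of \<alpha> \<beta>]) (simp add: matrix_matrix_mult_def)
qed

text \<open>
  Insert \<open>F = I + c / z + O(1 / z\<^sup>2)\<close> into \<open>(\<alpha> z + \<beta>) F = F' + F \<kappa>\<close> and compare coefficients along the
  imaginary axis. Order \<open>z\<close> gives \<open>\<alpha> = diag p\<close> and order 1 gives \<open>\<beta> = diag q + [c, diag p]\<close>. At order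
  \<open>1 / z\<close> the remainder of \<open>F\<close>, of which only the size is known, enters through its commutator with
  \<open>diag p\<close>; the entry at \<open>i, j\<close> of that commutator vanishes when \<open>p i = p j\<close>. The other terms give
  the identity.
\<close>

theorem coefficient_identity:
  assumes pij: "p i = p j"
  shows "(\<Sum>k\<in>UNIV. c $ i $ k * (p k - p i) * c $ k $ j) + (q i - q j) * c $ i $ j =
    (if i = j then of_int (\<nu> j) else 0)"
proof -
  obtain \<alpha> \<beta> where lax: "\<And>z i j. z \<notin> \<real> \<Longrightarrow>
      (\<Sum>k\<in>UNIV. (\<alpha> i k * z + \<beta> i k) * F z $ k $ j) =
      deriv (\<lambda>w. F w $ i $ j) z + F z $ i $ j * \<kappa> j z"
    by (rule lax_matrix_linear) blast
  have sum_mat: "(\<Sum>k\<in>UNIV. f k * mat 1 $ k $ j) = f j" for f :: "'n \<Rightarrow> complex" and j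
    by (simp add: mat_def if_distrib cong: if_cong)
  have sum_mat': "(\<Sum>k\<in>UNIV. mat 1 $ i $ k * f k) = f i" for f :: "'n \<Rightarrow> complex" and i
    by (simp add: mat_def mult_if_delta)
  note intros = tendsto_intros F_tendsto F_tendsto_coefficient deriv_F_tendsto
    tendsto_divide_upward
  have deriv_null: "((\<lambda>z. deriv (\<lambda>w. F w $ i $ j) z) \<longlongrightarrow> 0) upward" for i j
  proof (rule Lim_transform_eventually)
    show "((\<lambda>z. z * deriv (\<lambda>w. F w $ i $ j) z * (1 / z)) \<longlongrightarrow> 0) upward"
      using tendsto_mult[OF deriv_F_tendsto tendsto_divide_upward[of 1]] by (simp only: mult_zero_right)
    show "eventually (\<lambda>z. z * deriv (\<lambda>w. F w $ i $ j) z * (1 / z) = deriv (\<lambda>w. F w $ i $ j) z) upward"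
      using eventually_upward[of 1] by eventually_elim auto
  qed
  have \<alpha>: "\<alpha> i j = mat 1 $ i $ j * p j" for i j
  proof -
    have "((\<lambda>z. deriv (\<lambda>w. F w $ i $ j) z * (1 / z) +
          F z $ i $ j * (of_int (\<nu> j) / z * (1 / z) + p j + q j / z) -
          (\<Sum>k\<in>UNIV. \<beta> i k / z * F z $ k $ j))
        \<longlongrightarrow> 0 * 0 + mat 1 $ i $ j * (0 * 0 + p j + 0) - (\<Sum>k\<in>UNIV. 0 * mat 1 $ k $ j)) upward"
      by (intro intros deriv_null)
    moreover have "eventually (\<lambda>z. deriv (\<lambda>w. F w $ i $ j) z * (1 / z) +
          F z $ i $ j * (of_int (\<nu> j) / z * (1 / z) + p j + q j / z) -
          (\<Sum>k\<in>UNIV. \<beta> i k / z * F z $ k $ j) = (\<Sum>k\<in>UNIV. \<alpha> i k * F z $ k $ j)) upward"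
      using eventually_upward[of 1]
    proof eventually_elim
      case (elim z)
      have "(\<Sum>k\<in>UNIV. \<alpha> i k * F z $ k $ j) + (\<Sum>k\<in>UNIV. \<beta> i k / z * F z $ k $ j) =
          (\<Sum>k\<in>UNIV. (\<alpha> i k * z + \<beta> i k) * F z $ k $ j) / z"
        using elim by (simp add: sum_divide_distrib field_simps flip: sum.distrib)
      also have "\<dots> = deriv (\<lambda>w. F w $ i $ j) z * (1 / z) +
          F z $ i $ j * (of_int (\<nu> j) / z * (1 / z) + p j + q j / z)"
        using elim lax[of z i j] by (simp add: \<kappa>_def field_simps)
      finally show ?case
        by (simp add: algebra_simps)
    qed
    ultimately have lim: "((\<lambda>z. \<Sum>k\<in>UNIV. \<alpha> i k * F z $ k $ j)
        \<longlongrightarrow> 0 * 0 + mat 1 $ i $ j * (0 * 0 + p j + 0) - (\<Sum>k\<in>UNIV. 0 * mat 1 $ k $ j)) upward"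
      by (rule Lim_transform_eventually)
    have lim': "((\<lambda>z. \<Sum>k\<in>UNIV. \<alpha> i k * F z $ k $ j) \<longlongrightarrow> (\<Sum>k\<in>UNIV. \<alpha> i k * mat 1 $ k $ j)) upward"
      by (intro intros)
    show ?thesis
      using tendsto_unique[OF upward_neq_bot lim lim'] by (simp add: sum_mat)
  qed
  \<comment> \<open>The equation after the terms of order \<open>z\<close> have cancelled; its last summand tends to the commutator of \<open>c\<close> and \<open>diag p\<close>.\<close>
  have lax': "(\<Sum>k\<in>UNIV. \<beta> i k * F z $ k $ j) =
      deriv (\<lambda>w. F w $ i $ j) z + F z $ i $ j * (of_int (\<nu> j) / z + q j) +
      z * (F z $ i $ j - mat 1 $ i $ j) * (p j - p i)" if "z \<notin> \<real>" for z i j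
  proof -
    have split: "(\<Sum>k\<in>UNIV. (\<alpha> i k * z + \<beta> i k) * F z $ k $ j) =
        (\<Sum>k\<in>UNIV. mat 1 $ i $ k * (p k * z * F z $ k $ j)) + (\<Sum>k\<in>UNIV. \<beta> i k * F z $ k $ j)"
      by (simp add: \<alpha> distrib_right sum.distrib mult.assoc)
    have diagonal: "z * (F z $ i $ j - mat 1 $ i $ j) * (p j - p i) = z * F z $ i $ j * (p j - p i)"
      by (simp add: mat_def)
    show ?thesis
      using lax[OF that, of i j] split unfolding sum_mat' diagonal by (simp add: \<kappa>_def algebra_simps)
  qed
  have \<beta>: "\<beta> i j = mat 1 $ i $ j * q j + c $ i $ j * (p j - p i)" for i j
  proof -
    have "((\<lambda>z. deriv (\<lambda>w. F w $ i $ j) z + F z $ i $ j * (of_int (\<nu> j) / z + q j) +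
        z * (F z $ i $ j - mat 1 $ i $ j) * (p j - p i)) \<longlongrightarrow>
        0 + mat 1 $ i $ j * (0 + q j) + c $ i $ j * (p j - p i)) upward"
      by (intro intros deriv_null)
    moreover have "eventually (\<lambda>z. deriv (\<lambda>w. F w $ i $ j) z + F z $ i $ j * (of_int (\<nu> j) / z + q j) +
        z * (F z $ i $ j - mat 1 $ i $ j) * (p j - p i) = (\<Sum>k\<in>UNIV. \<beta> i k * F z $ k $ j)) upward"
      using eventually_upward[of 1] by eventually_elim (simp add: lax')
    ultimately have lim: "((\<lambda>z. \<Sum>k\<in>UNIV. \<beta> i k * F z $ k $ j) \<longlongrightarrow>
        0 + mat 1 $ i $ j * (0 + q j) + c $ i $ j * (p j - p i)) upward"
      by (rule Lim_transform_eventually)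
    have lim': "((\<lambda>z. \<Sum>k\<in>UNIV. \<beta> i k * F z $ k $ j) \<longlongrightarrow> (\<Sum>k\<in>UNIV. \<beta> i k * mat 1 $ k $ j)) upward"
      by (intro intros)
    show ?thesis
      using tendsto_unique[OF upward_neq_bot lim lim'] by (simp add: sum_mat)
  qed
  have "((\<lambda>z. z * deriv (\<lambda>w. F w $ i $ j) z + F z $ i $ j * of_int (\<nu> j) +
      q j * (z * (F z $ i $ j - mat 1 $ i $ j))) \<longlongrightarrow>
      0 + mat 1 $ i $ j * of_int (\<nu> j) + q j * c $ i $ j) upward"
    by (intro intros)
  moreover have "eventually (\<lambda>z. z * deriv (\<lambda>w. F w $ i $ j) z + F z $ i $ j * of_int (\<nu> j) +
      q j * (z * (F z $ i $ j - mat 1 $ i $ j)) =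
      (\<Sum>k\<in>UNIV. \<beta> i k * (z * (F z $ k $ j - mat 1 $ k $ j)))) upward"
    using eventually_upward[of 1]
  proof eventually_elim
    case (elim z)
    have expand: "(\<Sum>k\<in>UNIV. \<beta> i k * (z * (F z $ k $ j - mat 1 $ k $ j))) =
        z * (\<Sum>k\<in>UNIV. \<beta> i k * F z $ k $ j) - z * (\<Sum>k\<in>UNIV. \<beta> i k * mat 1 $ k $ j)"
      by (simp add: sum_distrib_left algebra_simps flip: sum_subtractf)
    have \<beta>_mat: "(\<Sum>k\<in>UNIV. \<beta> i k * mat 1 $ k $ j) = q j * mat 1 $ i $ j"
      by (simp add: sum_mat \<beta> pij)
    have "z * (\<Sum>k\<in>UNIV. \<beta> i k * F z $ k $ j) =
        z * deriv (\<lambda>w. F w $ i $ j) z + F z $ i $ j * of_int (\<nu> j) + z * q j * F z $ i $ j"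
      using elim lax'[of z i j] by (simp add: pij field_simps)
    then show ?case
      unfolding expand \<beta>_mat by (simp add: algebra_simps)
  qed
  ultimately have lim: "((\<lambda>z. \<Sum>k\<in>UNIV. \<beta> i k * (z * (F z $ k $ j - mat 1 $ k $ j))) \<longlongrightarrow>
      0 + mat 1 $ i $ j * of_int (\<nu> j) + q j * c $ i $ j) upward"
    by (rule Lim_transform_eventually)
  have lim': "((\<lambda>z. \<Sum>k\<in>UNIV. \<beta> i k * (z * (F z $ k $ j - mat 1 $ k $ j))) \<longlongrightarrow>
      (\<Sum>k\<in>UNIV. \<beta> i k * c $ k $ j)) upward"
    by (intro intros)
  have "(\<Sum>k\<in>UNIV. \<beta> i k * c $ k $ j) = mat 1 $ i $ j * of_int (\<nu> j) + q j * c $ i $ j"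
    using tendsto_unique[OF upward_neq_bot lim lim'] by simp
  moreover have "(\<Sum>k\<in>UNIV. \<beta> i k * c $ k $ j) =
      (\<Sum>k\<in>UNIV. mat 1 $ i $ k * (q k * c $ k $ j)) +
      (\<Sum>k\<in>UNIV. c $ i $ k * (p k - p i) * c $ k $ j)"
    by (simp add: \<beta> distrib_right sum.distrib mult.assoc)
  ultimately show ?thesis
    unfolding sum_mat' by (simp add: mat_def algebra_simps)
qed

end

section \<open>The four by four problem\<close>

lemma vector_4:
  "(vector [w, x, y, z] :: 'a::zero^4) $ 1 = w"
  "(vector [w, x, y, z] :: 'a::zero^4) $ 2 = x"
  "(vector [w, x, y, z] :: 'a::zero^4) $ 3 = y"
  "(vector [w, x, y, z] :: 'a::zero^4) $ 4 = z"
  by (simp_all add: vector_def)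

text \<open>
  Only the identity permutation contributes: the last two rows are those of the identity matrix,
  and the two remaining off-diagonal entries of the upper left block vanish.
\<close>

lemma det_jump_matrix: "det (jump_matrix A) = 1"
proof -
  have entries: "jump_matrix A $ 3 $ j = mat 1 $ 3 $ j" "jump_matrix A $ 4 $ j = mat 1 $ 4 $ j"
    "jump_matrix A $ 1 $ 2 = 0" "jump_matrix A $ 2 $ 1 = 0" for j
    using exhaust_4[of j] by (auto simp: jump_matrix_def vector_4 mat_def)
  have "\<exists>i. jump_matrix A $ i $ p i = 0" if p: "p permutes UNIV" and "p \<noteq> id" for p
  proof (rule ccontr)
    assume "\<nexists>i. jump_matrix A $ i $ p i = 0"
    then have nz: "jump_matrix A $ i $ p i \<noteq> 0" for i
      by blast
    have inj: "p i = p j \<Longrightarrow> i = j" for i j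
      using permutes_inj[OF p] by (auto dest: injD)
    have 34: "p 3 = 3" "p 4 = 4"
      using nz[of 3] nz[of 4] by (auto simp: entries mat_def split: if_splits)
    have "p 1 \<noteq> 2" "p 2 \<noteq> 1"
      using nz[of 1] nz[of 2] entries by metis+
    moreover have "p 1 \<noteq> 3" "p 1 \<noteq> 4" "p 2 \<noteq> 3" "p 2 \<noteq> 4"
      using inj[of 1 3] inj[of 1 4] inj[of 2 3] inj[of 2 4] 34 by auto
    ultimately have "p 1 = 1" "p 2 = 2"
      using exhaust_4[of "p 1"] exhaust_4[of "p 2"] by auto
    with 34 have "\<forall>i. p i = id i"
      by (simp add: forall_4)
    with \<open>p \<noteq> id\<close> show False by (auto simp: fun_eq_iff)
  qed
  then have "det (jump_matrix A) =
      (\<Sum>p\<in>{id}. of_int (sign p) * (\<Prod>i\<in>UNIV. jump_matrix A $ i $ p i))"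
    unfolding det_def by (intro sum.mono_neutral_right) (auto simp: permutes_id intro!: prod_zero)
  also have "\<dots> = (\<Prod>i\<in>UNIV. jump_matrix A $ i $ i)"
    by simp
  also have "\<dots> = 1"
    using forall_4[of "\<lambda>i. jump_matrix A $ i $ i = 1"]
    by (simp add: jump_matrix_def vector_4)
  finally show ?thesis .
qed

definition tuple4 :: "complex \<Rightarrow> complex \<Rightarrow> complex \<Rightarrow> complex \<Rightarrow> 4 \<Rightarrow> complex" where
  "tuple4 w x y z k = vector [w, x, y, z] $ k"

lemma tuple4: "tuple4 w x y z 1 = w" "tuple4 w x y z 2 = x" "tuple4 w x y z 3 = y" "tuple4 w x y z 4 = z"
  by (simp_all add: tuple4_def vector_4)

lemma diag4_eq: "diag4 w x y z = diag (tuple4 w x y z)"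
  by (simp add: vec_eq_iff diag4_def diag_def forall_4 vector_4 tuple4)

text \<open>
  \<open>exp (p x\<^sup>2 / 2 + q x)\<close>, with the components of \<open>lax_p\<close> and \<open>lax_q\<close> in order, is one of
  \<open>w1 1, w1 2, 1 / w2 1, 1 / w2 2\<close>.
\<close>

definition lax_p :: "real \<Rightarrow> real \<Rightarrow> 4 \<Rightarrow> complex" where
  "lax_p N t = tuple4 (of_real (- (N / t))) (of_real (- (N / t)))
                   (of_real (N / (1 - t))) (of_real (N / (1 - t)))"

definition lax_q :: "real \<Rightarrow> real \<Rightarrow> real^2 \<Rightarrow> real^2 \<Rightarrow> 4 \<Rightarrow> complex" where
  "lax_q N t a b = tuple4 (of_real (N * a $ 1 / t)) (of_real (N * a $ 2 / t))
     (of_real (- (N * b $ 1 / (1 - t)))) (of_real (- (N * b $ 2 / (1 - t))))"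

definition exponents :: "nat^2 \<Rightarrow> nat^2 \<Rightarrow> 4 \<Rightarrow> int" where
  "exponents n m k = vector [int (n $ 1), int (n $ 2), - int (m $ 1), - int (m $ 2)] $ k"

lemma exponents:
  "exponents n m 1 = int (n $ 1)" "exponents n m 2 = int (n $ 2)"
  "exponents n m 3 = - int (m $ 1)" "exponents n m 4 = - int (m $ 2)"
  by (simp_all add: exponents_def vector_4)

text \<open>
  The weight matrix is \<open>w1 k * w2 l\<close>, so conjugation by the diagonal matrix of \<open>w1 k\<close> and \<open>1 / w2 l\<close>
  turns each of its entries into 1.
\<close>

lemma jump_matrix_conjugate:
  "jump_matrix (W N t a b x) **
     diag (\<lambda>k. exp (lax_p N t k * (of_real x)\<^sup>2 / 2 + lax_q N t a b k * of_real x)) =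
   diag (\<lambda>k. exp (lax_p N t k * (of_real x)\<^sup>2 / 2 + lax_q N t a b k * of_real x)) **
     jump_matrix (\<chi> k l. 1)"
proof -
  define g where "g k = exp (lax_p N t k * (of_real x)\<^sup>2 / 2 + lax_q N t a b k * of_real x)" for k
  have w1: "complex_of_real (w1 N t a 1 x) = g 1" "complex_of_real (w1 N t a 2 x) = g 2"
    by (simp_all add: w1_def g_def lax_p_def lax_q_def tuple4 exp_of_real[symmetric]
        algebra_simps diff_divide_distrib add_divide_distrib)
  \<comment> \<open>With \<open>1 - t\<close> as an atom the exponents cancel termwise.\<close>
  obtain u where u: "1 - t = u"
    by blast
  have w2: "complex_of_real (w2 N t b 1 x) * g 3 = 1" "complex_of_real (w2 N t b 2 x) * g 4 = 1"
    by (simp_all add: w2_def g_def u lax_p_def lax_q_def tuple4 exp_of_real[symmetric] exp_add[symmetric]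
        algebra_simps diff_divide_distrib add_divide_distrib)
  have "jump_matrix (W N t a b x) $ i $ j * g j = g i * jump_matrix (\<chi> k l. 1) $ i $ j" for i j
    using exhaust_4[of i] exhaust_4[of j] w2
    by (auto simp: jump_matrix_def vector_4 W_def w1 mult_ac)
  then show ?thesis
    by (simp add: vec_eq_iff matrix_mult_diag flip: g_def)
      (simp add: diag_def matrix_matrix_mult_def if_distrib if_distribR cong: if_cong)
qed

lemma RH_solution_imp_gaussian_RH_problem:
  assumes nm: "n $ 1 + n $ 2 = m $ 1 + m $ 2"
    and RH: "RH_solution (W N t a b) n m Y c"
  obtains F \<rho> K where
    "gaussian_RH_problem (lax_p N t) (lax_q N t a b) (exponents n m) (jump_matrix (\<chi> k l. 1)) Y F c \<rho> K"
proof -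
  obtain R where Y: "\<And>z. z \<notin> \<real> \<Longrightarrow>
      Y z = (mat 1 + (\<chi> i j. c $ i $ j / z) + R z) **
        diag4 (z ^ (n $ 1)) (z ^ (n $ 2)) (z powi (- int (m $ 1))) (z powi (- int (m $ 2)))"
    and R: "\<And>i j. (\<lambda>z. R z $ i $ j) \<in> O[inf at_infinity (principal (- \<real>))](\<lambda>z. z powi (- 2))"
    using RH unfolding RH_solution_def by blast
  define bound where "bound i j K \<longleftrightarrow> K > 0 \<and>
      eventually (\<lambda>z. z \<notin> \<real> \<longrightarrow> norm (R z $ i $ j) \<le> K * norm (z powi (- 2))) at_infinity" for i j K
  have "\<exists>K. bound i j K" for i j
    using R[of i j] unfolding bound_def
    by (elim landau_o.bigE) (auto simp: eventually_inf_principal)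
  then obtain K where "\<And>i j. bound i j (K i j)"
    by metis
  then have K: "\<And>i j. K i j > 0"
    "\<And>i j. eventually (\<lambda>z. z \<notin> \<real> \<longrightarrow> norm (R z $ i $ j) \<le> K i j * norm (z powi (- 2))) at_infinity"
    by (simp_all add: bound_def)
  have "eventually (\<lambda>z. \<forall>i j. z \<notin> \<real> \<longrightarrow> norm (R z $ i $ j) \<le> K i j * norm (z powi (- 2))) at_infinity"
    by (intro eventually_all_finite K)
  then obtain \<rho> where \<rho>: "\<And>z i j. \<lbrakk>\<rho> \<le> norm z; z \<notin> \<real>\<rbrakk> \<Longrightarrow> norm (R z $ i $ j) \<le> K i j * norm (z powi (- 2))"
    unfolding eventually_at_infinity by blast
  define K' where "K' = (\<Sum>i\<in>UNIV. \<Sum>j\<in>UNIV. K i j)"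
  have K': "K i j \<le> K'" for i j
  proof -
    have "K i j \<le> (\<Sum>j\<in>UNIV. K i j)"
      by (rule member_le_sum) (auto intro: less_imp_le K)
    also have "\<dots> \<le> K'"
      unfolding K'_def by (rule member_le_sum) (auto intro: sum_nonneg less_imp_le K)
    finally show ?thesis .
  qed
  show thesis
  proof (rule that[of "\<lambda>z. mat 1 + (\<chi> i j. c $ i $ j / z) + R z" "max \<rho> 1" K'], unfold_locales)
    show "(\<lambda>z. Y z $ i $ j) holomorphic_on - \<real>" for i j
      using RH unfolding RH_solution_def by (blast intro: analytic_imp_holomorphic)
    show "det (jump_matrix (\<chi> k l. 1)) = 1"
      by (rule det_jump_matrix)
    show "(\<Sum>k\<in>UNIV. exponents n m k) = 0"
      using nm by (simp add: sum_4 exponents)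
    show "1 \<le> max \<rho> 1"
      by simp
    fix x :: real
    obtain Yp Ym where lim: "(Y \<longlongrightarrow> Yp) (at (complex_of_real x) within {z. Im z > 0})"
        "(Y \<longlongrightarrow> Ym) (at (complex_of_real x) within {z. Im z < 0})"
      and Yp: "Yp = Ym ** jump_matrix (W N t a b x)"
      using RH unfolding RH_solution_def by blast
    show "\<exists>Yp Ym. (Y \<longlongrightarrow> Yp) (at (complex_of_real x) within {z. Im z > 0}) \<and>
        (Y \<longlongrightarrow> Ym) (at (complex_of_real x) within {z. Im z < 0}) \<and>
        Yp ** diag (\<lambda>k. exp (lax_p N t k * (of_real x)\<^sup>2 / 2 + lax_q N t a b k * of_real x)) =
        Ym ** diag (\<lambda>k. exp (lax_p N t k * (of_real x)\<^sup>2 / 2 + lax_q N t a b k * of_real x)) **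
          jump_matrix (\<chi> k l. 1)"
      using lim by (intro exI[of _ Yp] exI[of _ Ym])
        (simp add: Yp jump_matrix_conjugate flip: matrix_mul_assoc)
  next
    fix z :: complex assume z: "z \<notin> \<real>"
    have "tuple4 (z ^ (n $ 1)) (z ^ (n $ 2)) (z powi (- int (m $ 1))) (z powi (- int (m $ 2))) k =
        z powi exponents n m k" for k
      using exhaust_4[of k] by (auto simp: tuple4 exponents)
    then have "tuple4 (z ^ (n $ 1)) (z ^ (n $ 2)) (z powi (- int (m $ 1))) (z powi (- int (m $ 2))) =
        (\<lambda>k. z powi exponents n m k)"
      by (rule ext)
    then show "Y z = (mat 1 + (\<chi> i j. c $ i $ j / z) + R z) ** diag (\<lambda>k. z powi exponents n m k)"
      by (simp only: Y[OF z] diag4_eq)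
    fix i j assume large: "max \<rho> 1 \<le> norm z"
    have "norm (R z $ i $ j) \<le> K i j * norm (z powi (- 2))"
      using large z by (intro \<rho>) auto
    also have "\<dots> \<le> K' * norm (z powi (- 2))"
      by (intro mult_right_mono K') auto
    also have "\<dots> = K' / (norm z)\<^sup>2"
      by (simp add: power_int_minus norm_inverse norm_power divide_inverse)
    finally show "norm ((mat 1 + (\<chi> i j. c $ i $ j / z) + R z) $ i $ j - mat 1 $ i $ j - c $ i $ j / z) \<le> K' / (norm z)\<^sup>2"
      by simp
  qed
qed

theorem proposition1p8:
  fixes a b :: "real^2" and N t :: real and n m :: "nat^2"
    and Y :: "complex \<Rightarrow> complex^4^4" and c :: "complex^4^4"
  assumes a: "a $ 1 > a $ 2" and b: "b $ 1 > b $ 2"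
    and N: "N > 0" and t: "t \<in> {0<..<1}"
    and n_pos: "\<forall>k. n $ k > 0" and m_pos: "\<forall>l. m $ l > 0"
    and nm: "n $ 1 + n $ 2 = m $ 1 + m $ 2"
    and Y: "RH_solution (W N t a b) n m Y c"
  defines "M \<equiv> (vector
      [vector [c $ 1 $ 3 * c $ 3 $ 1, c $ 1 $ 4 * c $ 4 $ 1],
       vector [c $ 2 $ 3 * c $ 3 $ 2, c $ 2 $ 4 * c $ 4 $ 2]] :: complex^2^2)"
  shows "(\<forall>k. (\<Sum>l\<in>UNIV. M $ k $ l) = complex_of_real (t * (1 - t) * (real (n $ k) / N))) \<and>
    (\<forall>l. (\<Sum>k\<in>UNIV. M $ k $ l) = complex_of_real (t * (1 - t) * (real (m $ l) / N))) \<and>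
    (n $ 1 = m $ 1 \<and> n $ 2 = m $ 2 \<longrightarrow>
       c $ 2 $ 3 * c $ 3 $ 2 = c $ 1 $ 4 * c $ 4 $ 1 \<and>
       c $ 1 $ 3 * c $ 3 $ 1 =
         complex_of_real (t * (1 - t) * (real (n $ 1) / N)) - c $ 1 $ 4 * c $ 4 $ 1 \<and>
       c $ 2 $ 4 * c $ 4 $ 2 =
         complex_of_real (t * (1 - t) * (real (n $ 2) / N)) - c $ 1 $ 4 * c $ 4 $ 1 \<and>
       complex_of_real (t\<^sup>2 * (b $ 1 - b $ 2)\<^sup>2) * (c $ 3 $ 4 * c $ 4 $ 3) =
         complex_of_real ((1 - t)\<^sup>2 * (a $ 1 - a $ 2)\<^sup>2) * (c $ 1 $ 2 * c $ 2 $ 1))"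
proof -
  obtain F \<rho> K where
    "gaussian_RH_problem (lax_p N t) (lax_q N t a b) (exponents n m) (jump_matrix (\<chi> k l. 1)) Y F c \<rho> K"
    using RH_solution_imp_gaussian_RH_problem[OF nm Y] .
  then interpret gaussian_RH_problem "lax_p N t" "lax_q N t a b" "exponents n m"
    "jump_matrix (\<chi> k l. 1)" Y F c \<rho> K .
  note identity = coefficient_identity[unfolded sum_4]
  \<comment> \<open>The values of \<open>p\<close> on the two blocks differ by \<open>1 / s\<close>; the differences of \<open>q\<close> inside the blocks are \<open>\<delta>a / s\<close> and \<open>- \<delta>b / s\<close>.\<close>
  define s where "s = complex_of_real (t * (1 - t) / N)"
  define \<delta>a where "\<delta>a = complex_of_real ((1 - t) * (a $ 1 - a $ 2))"
  define \<delta>b where "\<delta>b = complex_of_real (t * (b $ 1 - b $ 2))"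
  have t': "t > 0" "1 - t > 0"
    using t by auto
  have inverse_s: "1 / s = complex_of_real (N / (t * (1 - t)))"
    "\<delta>a / s = complex_of_real ((a $ 1 - a $ 2) * (N / t))"
    "\<delta>b / s = complex_of_real ((b $ 1 - b $ 2) * (N / (1 - t)))"
    unfolding s_def \<delta>a_def \<delta>b_def of_real_divide[symmetric] of_real_eq_iff
    using t' by simp_all
  obtain P where p: "lax_p N t 1 = P" "lax_p N t 2 = P" "lax_p N t 3 = P + 1 / s" "lax_p N t 4 = P + 1 / s"
  proof
    have "complex_of_real (N / (1 - t)) = complex_of_real (- (N / t)) + 1 / s"
      unfolding inverse_s of_real_add[symmetric] of_real_eq_iff using t' by (simp add: field_simps)
    then show "lax_p N t 3 = complex_of_real (- (N / t)) + 1 / s"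
      "lax_p N t 4 = complex_of_real (- (N / t)) + 1 / s"
      by (simp_all only: lax_p_def tuple4)
  qed (simp_all only: lax_p_def tuple4)
  obtain Q where qa: "lax_q N t a b 1 = Q + \<delta>a / s" "lax_q N t a b 2 = Q"
  proof
    show "lax_q N t a b 1 = complex_of_real (N * a $ 2 / t) + \<delta>a / s"
      unfolding inverse_s lax_q_def tuple4 of_real_add[symmetric] of_real_eq_iff
      by (simp add: algebra_simps diff_divide_distrib)
  qed (simp only: lax_q_def tuple4)
  obtain Q' where qb: "lax_q N t a b 3 = Q' - \<delta>b / s" "lax_q N t a b 4 = Q'"
  proof
    show "lax_q N t a b 3 = complex_of_real (- (N * b $ 2 / (1 - t))) - \<delta>b / s"
      unfolding inverse_s lax_q_def tuple4 of_real_diff[symmetric] of_real_eq_iff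
      by (simp add: algebra_simps diff_divide_distrib)
  qed (simp only: lax_q_def tuple4)
  have s: "s \<noteq> 0"
    using t' N by (simp add: s_def)
  \<comment> \<open>The identities at the diagonal positions are the row and column sums.\<close>
  have row1: "c $ 1 $ 3 * c $ 3 $ 1 + c $ 1 $ 4 * c $ 4 $ 1 = s * of_nat (n $ 1)"
    using identity[of 1 1] s by (simp add: p qa qb exponents field_simps)
  have row2: "c $ 2 $ 3 * c $ 3 $ 2 + c $ 2 $ 4 * c $ 4 $ 2 = s * of_nat (n $ 2)"
    using identity[of 2 2] s by (simp add: p qa qb exponents field_simps)
  have col1: "c $ 1 $ 3 * c $ 3 $ 1 + c $ 2 $ 3 * c $ 3 $ 2 = s * of_nat (m $ 1)"
    using identity[of 3 3] s by (simp add: p qa qb exponents field_simps)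
  have col2: "c $ 1 $ 4 * c $ 4 $ 1 + c $ 2 $ 4 * c $ 4 $ 2 = s * of_nat (m $ 2)"
    using identity[of 4 4] s by (simp add: p qa qb exponents field_simps)
  \<comment> \<open>Those at the off-diagonal positions inside the two blocks express
    \<open>c\<^sub>1\<^sub>2, c\<^sub>2\<^sub>1, c\<^sub>3\<^sub>4, c\<^sub>4\<^sub>3\<close> by the other entries.\<close>
  have c12: "\<delta>a * c $ 1 $ 2 = - (c $ 1 $ 3 * c $ 3 $ 2 + c $ 1 $ 4 * c $ 4 $ 2)"
    using identity[of 1 2] s by (simp add: p qa qb exponents field_simps add_eq_0_iff)
  have "s * (\<delta>a * c $ 2 $ 1) = s * (c $ 2 $ 3 * c $ 3 $ 1 + c $ 2 $ 4 * c $ 4 $ 1)"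
    using identity[of 2 1] s by (simp add: p qa qb exponents field_simps add_eq_0_iff)
  then have c21: "\<delta>a * c $ 2 $ 1 = c $ 2 $ 3 * c $ 3 $ 1 + c $ 2 $ 4 * c $ 4 $ 1"
    using s by simp
  have "- (s * (c $ 3 $ 1 * c $ 1 $ 4)) = \<delta>b * (s * c $ 3 $ 4) + s * (c $ 3 $ 2 * c $ 2 $ 4)"
    using identity[of 3 4] s by (simp add: p qa qb exponents field_simps)
  then have "s * (\<delta>b * c $ 3 $ 4 + (c $ 3 $ 1 * c $ 1 $ 4 + c $ 3 $ 2 * c $ 2 $ 4)) = 0"
    by algebra
  then have c34: "\<delta>b * c $ 3 $ 4 = - (c $ 3 $ 1 * c $ 1 $ 4 + c $ 3 $ 2 * c $ 2 $ 4)"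
    using s eq_neg_iff_add_eq_0 by (metis mult_eq_0_iff)
  have "s * (\<delta>b * c $ 4 $ 3) = s * (c $ 4 $ 1 * c $ 1 $ 3 + c $ 4 $ 2 * c $ 2 $ 3)"
    using identity[of 4 3] s by (simp add: p qa qb exponents field_simps add_eq_0_iff)
  then have c43: "\<delta>b * c $ 4 $ 3 = c $ 4 $ 1 * c $ 1 $ 3 + c $ 4 $ 2 * c $ 2 $ 3"
    using s by simp
  have s_mult: "complex_of_real (t * (1 - t) * (real k / N)) = s * of_nat k" for k
    by (simp add: s_def)
  have sums: "(\<forall>k. (\<Sum>l\<in>UNIV. M $ k $ l) = complex_of_real (t * (1 - t) * (real (n $ k) / N))) \<and>
      (\<forall>l. (\<Sum>k\<in>UNIV. M $ k $ l) = complex_of_real (t * (1 - t) * (real (m $ l) / N)))"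
    unfolding forall_2 sum_2 s_mult M_def using row1 row2 col1 col2 by simp
  have relations: "c $ 2 $ 3 * c $ 3 $ 2 = c $ 1 $ 4 * c $ 4 $ 1 \<and>
      c $ 1 $ 3 * c $ 3 $ 1 = s * of_nat (n $ 1) - c $ 1 $ 4 * c $ 4 $ 1 \<and>
      c $ 2 $ 4 * c $ 4 $ 2 = s * of_nat (n $ 2) - c $ 1 $ 4 * c $ 4 $ 1 \<and>
      complex_of_real (t\<^sup>2 * (b $ 1 - b $ 2)\<^sup>2) * (c $ 3 $ 4 * c $ 4 $ 3) =
      complex_of_real ((1 - t)\<^sup>2 * (a $ 1 - a $ 2)\<^sup>2) * (c $ 1 $ 2 * c $ 2 $ 1)"
    if n: "n $ 1 = m $ 1" "n $ 2 = m $ 2"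
  proof (intro conjI)
    show c23: "c $ 2 $ 3 * c $ 3 $ 2 = c $ 1 $ 4 * c $ 4 $ 1"
      using row1 col1 n by (metis add_left_cancel)
    show "c $ 1 $ 3 * c $ 3 $ 1 = s * of_nat (n $ 1) - c $ 1 $ 4 * c $ 4 $ 1"
      using row1 by (simp add: algebra_simps)
    show "c $ 2 $ 4 * c $ 4 $ 2 = s * of_nat (n $ 2) - c $ 1 $ 4 * c $ 4 $ 1"
      using col2 n by (simp add: algebra_simps)
    have "complex_of_real (t\<^sup>2 * (b $ 1 - b $ 2)\<^sup>2) * (c $ 3 $ 4 * c $ 4 $ 3) =
        (\<delta>b * c $ 3 $ 4) * (\<delta>b * c $ 4 $ 3)"
      by (simp add: \<delta>b_def power2_eq_square mult_ac)
    \<comment> \<open>Both products expand into \<open>x u + y v\<close> or \<open>x y + u v\<close>, with \<open>x, y, u, v\<close> the entries of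
        \<open>M\<close> read by rows, plus the same mixed terms; the difference vanishes for \<open>y = u\<close>.\<close>
    also have "\<dots> = (\<delta>a * c $ 1 $ 2) * (\<delta>a * c $ 2 $ 1)"
      unfolding c12 c21 c34 c43 using c23 by algebra
    also have "\<dots> = complex_of_real ((1 - t)\<^sup>2 * (a $ 1 - a $ 2)\<^sup>2) * (c $ 1 $ 2 * c $ 2 $ 1)"
      by (simp add: \<delta>a_def power2_eq_square mult_ac)
    finally show "complex_of_real (t\<^sup>2 * (b $ 1 - b $ 2)\<^sup>2) * (c $ 3 $ 4 * c $ 4 $ 3) =
        complex_of_real ((1 - t)\<^sup>2 * (a $ 1 - a $ 2)\<^sup>2) * (c $ 1 $ 2 * c $ 2 $ 1)" .
  qed
  show ?thesis
    using sums relations unfolding s_mult by blast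
qed

end
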